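(* If $X$ is a connected based CW-complex of dimension $n$, then $N\mathcal{E}(X)\leq n$.
   Context: All spaces are based and have the based homotopy type of a CW-complex; all maps and homotopies preserve base points. For a connected space $X$, $[X,X]$ is the monoid (under composition) of based homotopy classes of based self-maps of $X$, and $\mathcal{E}(X)\subseteq[X,X]$ is the group of classes of self-homotopy equivalences. For a nonnegative integer $k$, $\mathcal{A}_\sharp^k(X)\subseteq[X,X]$ is the set of classes $f$ such that the induced map $\pi_i(f):\pi_i(X)\to\pi_i(X)$ is an isomorphism for all $i=0,1,\dots,k$. One always has $\mathcal{E}(X)\subseteq\mathcal{A}_\sharp^k(X)$. The self-closeness number of $X$ is $N\mathcal{E}(X)=\min\{k\geq 0 : \mathcal{A}_\sharp^k(X)=\mathcal{E}(X)\}$, with $N\mathcal{E}(X)=\infty$ if no such nonnegative integer $k$ exists. *)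

theory Defs
  imports "HOL-Analysis.Analysis" "HOL-Algebra.Group" "HOL-Library.Extended_Nat"
begin

section \<open>Homotopy classes of maps of pairs\<close>

text \<open>
  Maps of pairs \<open>(A, B) \<rightarrow> (X, {x})\<close>, and homotopies through such maps. With \<open>B = {a}\<close> these are
  based maps and based homotopies; with \<open>A\<close> a cube and \<open>B\<close> its boundary they represent elements
  of a homotopy group. Values outside \<open>topspace A\<close> are irrelevant: maps that agree on
  \<open>topspace A\<close> and send \<open>B\<close> to \<open>x\<close> are homotopic in this sense if \<open>B \<subseteq> topspace A\<close>.
\<close>

definition pair_maps :: "'a topology \<Rightarrow> 'a set \<Rightarrow> 'b topology \<Rightarrow> 'b \<Rightarrow> ('a \<Rightarrow> 'b) set" where
  "pair_maps A B X x = {f. continuous_map A X f \<and> (\<forall>b\<in>B. f b = x)}"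

definition pair_homotopic ::
    "'a topology \<Rightarrow> 'a set \<Rightarrow> 'b topology \<Rightarrow> 'b \<Rightarrow> (('a \<Rightarrow> 'b) \<times> ('a \<Rightarrow> 'b)) set" where
  "pair_homotopic A B X x = {(f, g). homotopic_with (\<lambda>h. \<forall>b\<in>B. h b = x) A X f g}"

abbreviation pair_class ::
    "'a topology \<Rightarrow> 'a set \<Rightarrow> 'b topology \<Rightarrow> 'b \<Rightarrow> ('a \<Rightarrow> 'b) \<Rightarrow> ('a \<Rightarrow> 'b) set" where
  "pair_class A B X x f \<equiv> pair_homotopic A B X x `` {f}"

definition pair_classes ::
    "'a topology \<Rightarrow> 'a set \<Rightarrow> 'b topology \<Rightarrow> 'b \<Rightarrow> ('a \<Rightarrow> 'b) set set" where
  "pair_classes A B X x = pair_maps A B X x // pair_homotopic A B X x"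

lemma equiv_pair_homotopic: "equiv (pair_maps A B X x) (pair_homotopic A B X x)"
proof (rule equivI)
  show "pair_homotopic A B X x \<subseteq> pair_maps A B X x \<times> pair_maps A B X x"
  proof clarify
    fix f g assume "(f, g) \<in> pair_homotopic A B X x"
    then have h: "homotopic_with (\<lambda>h. \<forall>b\<in>B. h b = x) A X f g"
      by (simp add: pair_homotopic_def)
    from homotopic_with_imp_continuous_maps[OF h] homotopic_with_imp_property[OF h]
    show "f \<in> pair_maps A B X x \<and> g \<in> pair_maps A B X x"
      by (simp add: pair_maps_def)
  qed
  show "refl_on (pair_maps A B X x) (pair_homotopic A B X x)"
    by (simp add: refl_on_def pair_homotopic_def pair_maps_def)
  show "sym (pair_homotopic A B X x)"
    by (simp add: sym_def pair_homotopic_def homotopic_with_sym)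
  show "trans (pair_homotopic A B X x)"
    by (rule transI) (simp add: pair_homotopic_def, rule homotopic_with_trans)
qed


section \<open>Homotopy groups\<close>

definition cube :: "nat \<Rightarrow> (nat \<Rightarrow> real) topology" where
  "cube i = subtopology (Euclidean_space i) {t. \<forall>j<i. 0 \<le> t j \<and> t j \<le> 1}"

definition cube_boundary :: "nat \<Rightarrow> (nat \<Rightarrow> real) set" where
  "cube_boundary i = {t \<in> topspace (cube i). \<exists>j<i. t j = 0 \<or> t j = 1}"

definition cube_concat :: "((nat \<Rightarrow> real) \<Rightarrow> 'a) \<Rightarrow> ((nat \<Rightarrow> real) \<Rightarrow> 'a) \<Rightarrow> (nat \<Rightarrow> real) \<Rightarrow> 'a" where
  "cube_concat u v =
     (\<lambda>t. if t 0 \<le> 1/2 then u (t(0 := 2 * t 0)) else v (t(0 := 2 * t 0 - 1)))"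

text \<open>
  For \<open>i = 0\<close> the cube is a point with empty boundary, so the carrier is the set of path
  components of \<open>X\<close>; the multiplication is meaningful only for \<open>i \<ge> 1\<close>.
\<close>

definition homotopy_group :: "nat \<Rightarrow> 'a topology \<Rightarrow> 'a \<Rightarrow> ((nat \<Rightarrow> real) \<Rightarrow> 'a) set monoid" where
  "homotopy_group i X x =
     \<lparr> carrier = pair_classes (cube i) (cube_boundary i) X x,
       mult = (\<lambda>c d. \<Union>u\<in>c. \<Union>v\<in>d. pair_class (cube i) (cube_boundary i) X x (cube_concat u v)),
       one = pair_class (cube i) (cube_boundary i) X x (\<lambda>t. x) \<rparr>"

definition homotopy_group_map ::
    "nat \<Rightarrow> 'b topology \<Rightarrow> 'b \<Rightarrow> ('a \<Rightarrow> 'b) \<Rightarrow> ((nat \<Rightarrow> real) \<Rightarrow> 'a) set \<Rightarrow> ((nat \<Rightarrow> real) \<Rightarrow> 'b) set" where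
  "homotopy_group_map i Y y f c =
     (\<Union>u\<in>c. pair_class (cube i) (cube_boundary i) Y y (f \<circ> u))"

definition induces_iso :: "nat \<Rightarrow> 'a topology \<Rightarrow> 'a \<Rightarrow> 'b topology \<Rightarrow> 'b \<Rightarrow> ('a \<Rightarrow> 'b) \<Rightarrow> bool" where
  "induces_iso i X x Y y f \<longleftrightarrow>
     (if i = 0
      then bij_betw (homotopy_group_map 0 Y y f)
             (carrier (homotopy_group 0 X x)) (carrier (homotopy_group 0 Y y))
      else homotopy_group_map i Y y f \<in> iso (homotopy_group i X x) (homotopy_group i Y y))"


section \<open>The self-closeness number\<close>

definition self_maps :: "'a topology \<Rightarrow> 'a \<Rightarrow> ('a \<Rightarrow> 'a) set" where
  "self_maps X x = pair_maps X {x} X x"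

abbreviation self_class :: "'a topology \<Rightarrow> 'a \<Rightarrow> ('a \<Rightarrow> 'a) \<Rightarrow> ('a \<Rightarrow> 'a) set" where
  "self_class X x f \<equiv> pair_class X {x} X x f"

definition based_homotopy_equivalence :: "'a topology \<Rightarrow> 'a \<Rightarrow> ('a \<Rightarrow> 'a) \<Rightarrow> bool" where
  "based_homotopy_equivalence X x f \<longleftrightarrow>
     f \<in> self_maps X x \<and>
     (\<exists>g \<in> self_maps X x. (g \<circ> f, id) \<in> pair_homotopic X {x} X x \<and>
                          (f \<circ> g, id) \<in> pair_homotopic X {x} X x)"

definition self_equivalence_classes :: "'a topology \<Rightarrow> 'a \<Rightarrow> ('a \<Rightarrow> 'a) set set" where
  "self_equivalence_classes X x = {self_class X x f | f. based_homotopy_equivalence X x f}"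

definition A_sharp :: "nat \<Rightarrow> 'a topology \<Rightarrow> 'a \<Rightarrow> ('a \<Rightarrow> 'a) set set" where
  "A_sharp k X x =
     {self_class X x f | f. f \<in> self_maps X x \<and> (\<forall>i\<le>k. induces_iso i X x X x f)}"

definition self_closeness_number :: "'a topology \<Rightarrow> 'a \<Rightarrow> enat" where
  "self_closeness_number X x =
     (if \<exists>k. A_sharp k X x = self_equivalence_classes X x
      then enat (LEAST k. A_sharp k X x = self_equivalence_classes X x)
      else \<infinity>)"


section \<open>CW-complexes\<close>

definition disc :: "nat \<Rightarrow> (nat \<Rightarrow> real) topology" where
  "disc k = subtopology (Euclidean_space k) {t. (\<Sum>j<k. (t j)\<^sup>2) \<le> 1}"

definition disc_interior :: "nat \<Rightarrow> (nat \<Rightarrow> real) set" where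
  "disc_interior k = {t \<in> topspace (disc k). (\<Sum>j<k. (t j)\<^sup>2) < 1}"

definition disc_boundary :: "nat \<Rightarrow> (nat \<Rightarrow> real) set" where
  "disc_boundary k = {t \<in> topspace (disc k). (\<Sum>j<k. (t j)\<^sup>2) = 1}"

text \<open>
  Whitehead's definition: a Hausdorff space partitioned into open cells, with characteristic maps
  \<open>\<Phi> j\<close> from the disc of dimension \<open>d j\<close>, for \<open>j \<in> J\<close>, that is closure-finite and carries
  the weak topology. The set \<open>\<Phi> j ` topspace (disc (d j))\<close> is the closed cell.
\<close>

definition CW_complex ::
    "'a topology \<Rightarrow> 'j set \<Rightarrow> ('j \<Rightarrow> nat) \<Rightarrow> ('j \<Rightarrow> (nat \<Rightarrow> real) \<Rightarrow> 'a) \<Rightarrow> bool" where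
  "CW_complex X J d \<Phi> \<longleftrightarrow>
     Hausdorff_space X \<and>
     (\<forall>j\<in>J. continuous_map (disc (d j)) X (\<Phi> j) \<and>
            embedding_map (subtopology (disc (d j)) (disc_interior (d j))) X (\<Phi> j)) \<and>
     disjoint_family_on (\<lambda>j. \<Phi> j ` disc_interior (d j)) J \<and>
     (\<Union>j\<in>J. \<Phi> j ` disc_interior (d j)) = topspace X \<and>
     (\<forall>j\<in>J. \<exists>F. finite F \<and> F \<subseteq> J \<and> (\<forall>i\<in>F. d i < d j) \<and>
            \<Phi> j ` disc_boundary (d j) \<subseteq> (\<Union>i\<in>F. \<Phi> i ` disc_interior (d i))) \<and>
     (\<forall>S \<subseteq> topspace X.
        closedin X S \<longleftrightarrow> (\<forall>j\<in>J. closedin X (S \<inter> \<Phi> j ` topspace (disc (d j)))))"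

text \<open>The base point of a based CW-complex is a vertex.\<close>

definition based_CW_complex ::
    "'a topology \<Rightarrow> 'a \<Rightarrow> 'j set \<Rightarrow> ('j \<Rightarrow> nat) \<Rightarrow> ('j \<Rightarrow> (nat \<Rightarrow> real) \<Rightarrow> 'a) \<Rightarrow> bool" where
  "based_CW_complex X x J d \<Phi> \<longleftrightarrow>
     CW_complex X J d \<Phi> \<and> (\<exists>j\<in>J. d j = 0 \<and> x \<in> \<Phi> j ` disc_interior 0)"

definition has_CW_dimension :: "'j set \<Rightarrow> ('j \<Rightarrow> nat) \<Rightarrow> nat \<Rightarrow> bool" where
  "has_CW_dimension J d n \<longleftrightarrow> (\<forall>j\<in>J. d j \<le> n) \<and> (\<exists>j\<in>J. d j = n)"

end

theory Submission
  imports Defs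
begin

text \<open>
  The sets \<open>A_sharp n X x\<close> and \<open>self_equivalence_classes X x\<close> are equal. One inclusion is the
  functoriality of homotopy groups (\<open>based_homotopy_equivalence_induces_iso\<close>). For the other one
  let \<open>f\<close> induce isomorphisms on \<open>\<pi>\<^sub>i\<close> for \<open>i \<le> n\<close>.

  Obstruction theory produces a right inverse of \<open>f\<close> up to based homotopy: the identity of \<open>X\<close>, whose
  cells have dimension at most \<open>n\<close>, lifts through \<open>f\<close> cell by cell (\<open>complex_lifting\<close>). Over a
  \<open>k\<close>-cell, injectivity on \<open>\<pi>\<^bsub>k-1\<^esub>\<close> allows one to extend the lift from the boundary of the cell,
  and surjectivity on \<open>\<pi>\<^sub>k\<close> allows one to choose the extension so that the homotopy extends too
  (\<open>cube_lifting\<close>). The right inverse \<open>g\<close> again induces isomorphisms on \<open>\<pi>\<^sub>i\<close> for \<open>i \<le> n\<close>, namely the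
  inverses of those of \<open>f\<close>. So \<open>g\<close> has a right inverse as well, and a map with a left and a right
  inverse is invertible.

  The boundary of a cell is not mapped to the base point, so elements of homotopy groups are
  compared by homotopies of cubes that move the boundary in a prescribed way
  (\<open>homotopic_along\<close>). Their calculus is a consequence of the homotopy extension property of a cube
  relative to its boundary, applied to a cube and to the prism over it.
\<close>

section \<open>Cubes and the extension of homotopies from their boundary\<close>

lemma continuous_map_top_of_set_compose:
  assumes "continuous_map (top_of_set T) Y f" "continuous_on S g" "g \<in> S \<rightarrow> T"
  shows "continuous_map (top_of_set S) Y (\<lambda>x. f (g x))"
proof -
  have "continuous_map (top_of_set S) (top_of_set T) g"
    using assms(2,3) by simp
  from continuous_map_compose[OF this assms(1)] show ?thesis by (simp add: o_def)
qed

lemma continuous_map_top_of_set_subset: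
  assumes "continuous_map (top_of_set T) Y f" "S \<subseteq> T"
  shows "continuous_map (top_of_set S) Y f"
  using continuous_map_from_subtopology_mono[OF assms] .

lemma continuous_map_closed_cover:
  assumes "finite I" "\<And>i. i \<in> I \<Longrightarrow> closedin X (T i)" "topspace X \<subseteq> (\<Union>i\<in>I. T i)"
    and "\<And>i. i \<in> I \<Longrightarrow> continuous_map (subtopology X (T i)) Y g"
  shows "continuous_map X Y g"
  by (rule pasting_lemma_closed[of I X T Y "\<lambda>_. g"]) (use assms in auto)

lemma continuous_map_top_of_set_cases_le:
  fixes p q :: "'a::topological_space \<Rightarrow> real"
  assumes "continuous_on S p" "continuous_on S q"
    and "continuous_map (top_of_set {x\<in>S. p x \<le> q x}) Y f"
    and "continuous_map (top_of_set {x\<in>S. q x \<le> p x}) Y g"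
    and "\<And>x. x \<in> S \<Longrightarrow> p x = q x \<Longrightarrow> f x = g x"
  shows "continuous_map (top_of_set S) Y (\<lambda>x. if p x \<le> q x then f x else g x)"
proof (rule continuous_map_cases_le)
  have "S \<inter> {x \<in> topspace (top_of_set S). p x \<le> q x} = {x\<in>S. p x \<le> q x}"
       "S \<inter> {x \<in> topspace (top_of_set S). q x \<le> p x} = {x\<in>S. q x \<le> p x}" by auto
  then show "continuous_map (subtopology (top_of_set S) {x \<in> topspace (top_of_set S). p x \<le> q x}) Y f"
    "continuous_map (subtopology (top_of_set S) {x \<in> topspace (top_of_set S). q x \<le> p x}) Y g"
    using assms by (simp_all add: subtopology_subtopology)
qed (use assms in auto)

definition unit_cube :: "nat \<Rightarrow> (nat \<Rightarrow> real) set" where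
  "unit_cube m = {t. (\<forall>j<m. 0 \<le> t j \<and> t j \<le> 1) \<and> (\<forall>j\<ge>m. t j = 0)}"

lemma Euclidean_space_eq: "Euclidean_space m = top_of_set {t. \<forall>j\<ge>m. t j = 0}"
  by (simp add: Euclidean_space_def euclidean_product_topology)

lemma cube_eq: "cube m = top_of_set (unit_cube m)"
  unfolding cube_def Euclidean_space_eq subtopology_subtopology
  by (rule arg_cong[of _ _ top_of_set]) (auto simp: unit_cube_def)

lemma topspace_cube [simp]: "topspace (cube m) = unit_cube m"
  by (simp add: cube_eq)

text \<open>
  The gauge is the maximum norm of \<open>2 t - (1, \<dots>, 1)\<close>, that is, twice the maximum norm distance from the
  centre of the cube: the unit cube is \<open>cube_gauge m t \<le> 1\<close> and its boundary is \<open>cube_gauge m t = 1\<close>.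
  Recursion on the dimension avoids a maximum over an empty set in dimension 0.
\<close>

primrec cube_gauge :: "nat \<Rightarrow> (nat \<Rightarrow> real) \<Rightarrow> real" where
  "cube_gauge 0 t = 0"
| "cube_gauge (Suc m) t = max (cube_gauge m t) \<bar>2 * t m - 1\<bar>"

lemma cube_gauge_nonneg: "0 \<le> cube_gauge m t"
  by (induction m) auto

lemma cube_gauge_le_iff: "0 \<le> r \<Longrightarrow> cube_gauge m t \<le> r \<longleftrightarrow> (\<forall>j<m. \<bar>2 * t j - 1\<bar> \<le> r)"
  by (induction m) (auto simp: less_Suc_eq)

lemma cube_gauge_coord_le: "j < m \<Longrightarrow> \<bar>2 * t j - 1\<bar> \<le> cube_gauge m t"
  using cube_gauge_le_iff[OF cube_gauge_nonneg, of m t m t] by simp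

lemma cube_gauge_attained: "m > 0 \<Longrightarrow> \<exists>j<m. cube_gauge m t = \<bar>2 * t j - 1\<bar>"
proof (induction m)
  case (Suc m)
  show ?case
  proof (cases "cube_gauge m t \<le> \<bar>2 * t m - 1\<bar>")
    case False
    then have "m > 0" by (cases m) auto
    with Suc.IH False show ?thesis by (auto simp: less_Suc_eq)
  qed auto
qed simp

lemma mem_unit_cube_iff_gauge: "t \<in> unit_cube m \<longleftrightarrow> (\<forall>j\<ge>m. t j = 0) \<and> cube_gauge m t \<le> 1"
  unfolding unit_cube_def cube_gauge_le_iff[OF zero_le_one] by (auto simp: abs_le_iff) 

lemma mem_cube_boundary_iff_gauge: "t \<in> cube_boundary m \<longleftrightarrow> (\<forall>j\<ge>m. t j = 0) \<and> cube_gauge m t = 1"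
proof
  assume "t \<in> cube_boundary m"
  then obtain j where j: "t \<in> unit_cube m" "j < m" "\<bar>2 * t j - 1\<bar> = 1"
    by (auto simp: cube_boundary_def)
  then have "1 \<le> cube_gauge m t" using cube_gauge_coord_le by metis
  with j show "(\<forall>j\<ge>m. t j = 0) \<and> cube_gauge m t = 1" by (simp add: mem_unit_cube_iff_gauge)
next
  assume t: "(\<forall>j\<ge>m. t j = 0) \<and> cube_gauge m t = 1"
  then have "m > 0" by (cases m) auto
  from cube_gauge_attained[OF this, of t] t obtain j where "j < m" "\<bar>2 * t j - 1\<bar> = 1" by auto
  then have "t j = 0 \<or> t j = 1" by (auto simp: abs_if split: if_splits)
  with \<open>j < m\<close> t show "t \<in> cube_boundary m" by (auto simp: cube_boundary_def mem_unit_cube_iff_gauge)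
qed

lemma cube_boundary_subset: "cube_boundary m \<subseteq> unit_cube m"
  by (auto simp: cube_boundary_def)

lemma cube_boundary_0 [simp]: "cube_boundary 0 = {}"
  by (auto simp: cube_boundary_def)

lemma unit_cube_0 [simp]: "unit_cube 0 = {\<lambda>_. 0}"
  by (auto simp: unit_cube_def)

text \<open>
  Splitting a continuity goal into coordinates would hide updates of a single coordinate, for which
  the rule \<open>continuous_on_fun_upd\<close> below is the useful one.
\<close>

declare continuous_on_coordinatewise_then_product [continuous_intros del]

lemmas continuous_on_coord = continuous_on_product_then_coordinatewise

lemma continuous_on_snd_coord [continuous_intros]:
  "continuous_on S (\<lambda>z. snd (z :: 'a::topological_space \<times> (nat \<Rightarrow> real)) j)"
  by (rule continuous_on_coord[OF continuous_on_snd[OF continuous_on_id]])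

lemma continuous_on_cube_gauge [continuous_intros]:
  "continuous_on S g \<Longrightarrow> continuous_on S (\<lambda>x. cube_gauge m (g x))"
proof (induction m)
  case (Suc m)
  then show ?case by (auto intro!: continuous_intros continuous_on_coord[OF Suc.prems])
qed simp

lemma continuous_on_fun_upd [continuous_intros]:
  fixes g :: "'a::topological_space \<Rightarrow> nat \<Rightarrow> real"
  assumes "continuous_on S g" "continuous_on S r"
  shows "continuous_on S (\<lambda>x. (g x)(j := r x))"
proof (rule continuous_on_coordinatewise_then_product)
  show "continuous_on S (\<lambda>x. ((g x)(j := r x)) i)" for i
    using assms by (cases "i = j") (auto intro: continuous_on_coord[OF assms(1)])
qed

abbreviation prism :: "nat \<Rightarrow> (real \<times> (nat \<Rightarrow> real)) set" where
  "prism m \<equiv> {0..1} \<times> unit_cube m"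

text \<open>
  The homothety with ratio \<open>l\<close> about the centre of the cube, which multiplies the gauge by \<open>l\<close>.
\<close>

definition rescale :: "nat \<Rightarrow> real \<Rightarrow> (nat \<Rightarrow> real) \<Rightarrow> nat \<Rightarrow> real" where
  "rescale m l t = (\<lambda>j. if j < m then 1/2 + l * (t j - 1/2) else 0)"

lemma cube_gauge_rescale: "0 \<le> l \<Longrightarrow> cube_gauge m (rescale m l t) = l * cube_gauge m t"
proof -
  assume l: "0 \<le> l"
  have "k \<le> m \<Longrightarrow> cube_gauge k (rescale m l t) = l * cube_gauge k t" for k
  proof (induction k)
    case (Suc k)
    have "\<bar>2 * rescale m l t k - 1\<bar> = \<bar>l * (2 * t k - 1)\<bar>"
      using Suc.prems by (simp add: rescale_def algebra_simps)
    also have "\<dots> = l * \<bar>2 * t k - 1\<bar>" using l by (simp add: abs_mult)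
    finally show ?case using Suc l by (simp add: max_mult_distrib_left)
  qed simp
  then show ?thesis by simp
qed

lemma rescale_in_unit_cube: "0 \<le> l \<Longrightarrow> l * cube_gauge m t \<le> 1 \<Longrightarrow> rescale m l t \<in> unit_cube m"
  by (simp add: mem_unit_cube_iff_gauge cube_gauge_rescale) (simp add: rescale_def)

lemma rescale_1: "t \<in> unit_cube m \<Longrightarrow> rescale m 1 t = t"
  by (auto simp: rescale_def unit_cube_def fun_eq_iff)

lemma continuous_on_rescale [continuous_intros]:
  assumes "continuous_on S l" "continuous_on S g"
  shows "continuous_on S (\<lambda>x. rescale m (l x) (g x))"
  unfolding rescale_def
proof (rule continuous_on_coordinatewise_then_product)
  show "continuous_on S (\<lambda>x. if j < m then 1/2 + l x * (g x j - 1/2) else 0)" for j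
    using assms by (cases "j < m") (auto intro!: continuous_intros continuous_on_coord[OF assms(2)])
qed

text \<open>
  The cylinder over the cube retracts onto the union of its bottom and its walls by projection from
  the point above the centre at height 2. A point whose gauge is at most \<open>(2 - t) / 2\<close> lands on
  the bottom, every other one on a wall; the two branches of \<open>E\<close> are the composites of \<open>F\<close> and \<open>G\<close> with
  this projection.
\<close>

lemma cube_homotopy_extension:
  fixes G :: "real \<times> (nat \<Rightarrow> real) \<Rightarrow> 'a"
  assumes F: "continuous_map (top_of_set (unit_cube m)) Y F"
    and G: "continuous_map (top_of_set ({0..1} \<times> cube_boundary m)) Y G"
    and FG: "\<And>s. s \<in> cube_boundary m \<Longrightarrow> G (0, s) = F s"
  obtains E where "continuous_map (top_of_set (prism m)) Y E"
    "\<And>s. s \<in> unit_cube m \<Longrightarrow> E (0, s) = F s"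
    "\<And>t s. t \<in> {0..1} \<Longrightarrow> s \<in> cube_boundary m \<Longrightarrow> E (t, s) = G (t, s)"
proof
  let ?N = "cube_gauge m"
  define inner where "inner = (\<lambda>(t::real, s). rescale m (2 / (2 - t)) s)"
  define outer where "outer = (\<lambda>(t::real, s). (2 - (2 - t) / ?N s, rescale m (1 / ?N s) s))"
  define E where "E = (\<lambda>z. if 2 * ?N (snd z) \<le> 2 - fst z then F (inner z) else G (outer z))"
  let ?S = "prism m"
  have pos: "?N s > 0" if "t \<in> {0..1}" "2 * ?N s \<ge> 2 - t" for t s using that by auto
  show "continuous_map (top_of_set ?S) Y E"
    unfolding E_def
  proof (rule continuous_map_top_of_set_cases_le)
    show "continuous_map (top_of_set {z \<in> ?S. 2 * ?N (snd z) \<le> 2 - fst z}) Y (\<lambda>z. F (inner z))"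
    proof (rule continuous_map_top_of_set_compose[OF F])
      show "continuous_on {z \<in> ?S. 2 * ?N (snd z) \<le> 2 - fst z} inner"
        unfolding inner_def split_def by (intro continuous_intros) auto
      show "inner \<in> {z \<in> ?S. 2 * ?N (snd z) \<le> 2 - fst z} \<rightarrow> unit_cube m"
        by (auto simp: inner_def intro!: rescale_in_unit_cube)
    qed
    show "continuous_map (top_of_set {z \<in> ?S. 2 - fst z \<le> 2 * ?N (snd z)}) Y (\<lambda>z. G (outer z))"
    proof (rule continuous_map_top_of_set_compose[OF G])
      show "continuous_on {z \<in> ?S. 2 - fst z \<le> 2 * ?N (snd z)} outer"
        unfolding outer_def split_def using pos by (intro continuous_intros) fastforce+
      show "outer \<in> {z \<in> ?S. 2 - fst z \<le> 2 * ?N (snd z)} \<rightarrow> {0..1} \<times> cube_boundary m"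
      proof clarsimp
        fix t s assume ts: "0 \<le> t" "t \<le> 1" "s \<in> unit_cube m" "2 - t \<le> 2 * ?N s"
        then have N: "0 < ?N s" "?N s \<le> 1" using pos[of t s] by (auto simp: mem_unit_cube_iff_gauge)
        then have "?N s \<le> 2 - t" using ts by linarith
        then have "1 \<le> (2 - t) / ?N s" "(2 - t) / ?N s \<le> 2" using N ts by (simp_all add: field_simps)
        moreover have "rescale m (1 / ?N s) s \<in> cube_boundary m"
          using N by (simp add: mem_cube_boundary_iff_gauge cube_gauge_rescale) (simp add: rescale_def)
        ultimately show "outer (t, s) \<in> {0..1} \<times> cube_boundary m" by (simp add: outer_def)
      qed
    qed
    fix z assume z: "z \<in> ?S" "2 * ?N (snd z) = 2 - fst z"
    obtain t s where [simp]: "z = (t, s)" by (cases z)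
    from z have N: "?N s > 0" using pos[of t s] by auto
    from z have "2 / (2 - t) = 1 / ?N s" "(2 - t) / ?N s = 2" using N by (simp_all add: field_simps)
    then have *: "outer z = (0, inner z)" by (simp add: outer_def inner_def)
    have "inner z \<in> cube_boundary m"
      using N z by (auto simp: mem_cube_boundary_iff_gauge inner_def cube_gauge_rescale)
        (auto simp: rescale_def field_simps)
    then show "F (inner z) = G (outer z)" unfolding * by (rule FG[symmetric])
  qed (intro continuous_intros)+
  show "E (0, s) = F s" if "s \<in> unit_cube m" for s
    using that by (auto simp: E_def inner_def rescale_1 mem_unit_cube_iff_gauge[of s])
  show "E (t, s) = G (t, s)" if "t \<in> {0..1}" "s \<in> cube_boundary m" for t s
proof -
    have N: "?N s = 1" and s: "s \<in> unit_cube m" using that cube_boundary_subset[of m]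
      by (auto simp: mem_cube_boundary_iff_gauge)
    then show ?thesis using that by (auto simp: E_def inner_def outer_def rescale_1 FG)
  qed
qed

lemma unit_cube_Suc: "t \<in> unit_cube (Suc m) \<longleftrightarrow> t m \<in> {0..1} \<and> t(m := 0) \<in> unit_cube m"
  by (auto simp: unit_cube_def less_Suc_eq Suc_le_eq)

lemma cube_boundary_Suc:
  "t \<in> cube_boundary (Suc m) \<longleftrightarrow>
     t m \<in> {0..1} \<and> t(m := 0) \<in> unit_cube m \<and> (t m = 0 \<or> t m = 1 \<or> t(m := 0) \<in> cube_boundary m)"
  unfolding cube_boundary_def topspace_cube mem_Collect_eq unit_cube_Suc by (auto simp: less_Suc_eq)

lemma fun_upd_in_unit_cube_Suc: "s \<in> unit_cube m \<Longrightarrow> r \<in> {0..1} \<Longrightarrow> s(m := r) \<in> unit_cube (Suc m)"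
  by (auto simp: unit_cube_def less_Suc_eq)

lemma unit_cube_fun_upd_0 [simp]: "s \<in> unit_cube m \<Longrightarrow> s(m := 0) = s"
  by (auto simp: unit_cube_def)

lemma unit_cube_coord_0: "s \<in> unit_cube m \<Longrightarrow> s m = 0"
  by (auto simp: unit_cube_def)

text \<open>
  The prism over a cube is itself a cube, so that its boundary also has the homotopy extension property.
  Hence a map on that boundary that is homotopic to one which extends over the prism extends as well.
  The boundary consists of the two ends, on which the homotopies are \<open>A\<close> and \<open>B\<close>, and of the walls,
  on which it is \<open>C\<close>. The two composition laws for homotopies along \<open>\<beta>\<close> below are instances of this.
\<close>

lemma filling_deformation:
  fixes K A B :: "real \<times> (nat \<Rightarrow> real) \<Rightarrow> 'a" and C :: "real \<times> real \<times> (nat \<Rightarrow> real) \<Rightarrow> 'a"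
  assumes K: "continuous_map (top_of_set (prism m)) Y K"
    and A: "continuous_map (top_of_set (prism m)) Y A"
    and B: "continuous_map (top_of_set (prism m)) Y B"
    and C: "continuous_map (top_of_set ({0..1} \<times> {0..1} \<times> cube_boundary m)) Y C"
    and start: "\<And>s. s \<in> unit_cube m \<Longrightarrow> A (0, s) = K (0, s)" "\<And>s. s \<in> unit_cube m \<Longrightarrow> B (0, s) = K (1, s)"
      "\<And>r s. r \<in> {0..1} \<Longrightarrow> s \<in> cube_boundary m \<Longrightarrow> C (0, r, s) = K (r, s)"
    and edge: "\<And>t s. t \<in> {0..1} \<Longrightarrow> s \<in> cube_boundary m \<Longrightarrow> C (t, 0, s) = A (t, s)"
      "\<And>t s. t \<in> {0..1} \<Longrightarrow> s \<in> cube_boundary m \<Longrightarrow> C (t, 1, s) = B (t, s)"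
  obtains L where "continuous_map (top_of_set (prism m)) Y L"
    "\<And>s. s \<in> unit_cube m \<Longrightarrow> L (0, s) = A (1, s)" "\<And>s. s \<in> unit_cube m \<Longrightarrow> L (1, s) = B (1, s)"
    "\<And>r s. r \<in> {0..1} \<Longrightarrow> s \<in> cube_boundary m \<Longrightarrow> L (r, s) = C (1, r, s)"
proof -
  define F where "F = (\<lambda>s. K (s m, s(m := 0)))"
  define G where "G = (\<lambda>(t, s). if s m = 0 then A (t, s(m := 0)) else if s m = 1 then B (t, s(m := 0))
                               else C (t, s m, s(m := 0)))"
  let ?S = "{0..1} \<times> cube_boundary (Suc m) :: (real \<times> (nat \<Rightarrow> real)) set"
  have F: "continuous_map (top_of_set (unit_cube (Suc m))) Y F"
    unfolding F_def
    by (rule continuous_map_top_of_set_compose[OF K continuous_on_Pair[OF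
          continuous_on_coord[OF continuous_on_id] continuous_on_fun_upd[OF continuous_on_id continuous_on_const]]])
       (auto simp: unit_cube_Suc)
  define T where "T = (\<lambda>i::nat. if i = 0 then {z \<in> ?S. snd z m = 0} else if i = 1 then {z \<in> ?S. snd z m = 1}
      else {z \<in> ?S. (snd z)(m := 0) \<in> cube_boundary m})"
  have bd: "(snd z)(m := 0) \<in> cube_boundary m \<longleftrightarrow> cube_gauge m ((snd z)(m := 0)) = 1" if "z \<in> ?S" for z
    using that by (auto simp: mem_cube_boundary_iff_gauge cube_boundary_Suc unit_cube_def)
  have clo: "closedin (top_of_set ?S) {z \<in> ?S. h z = c}" if "continuous_on ?S h"
    for h :: "real \<times> (nat \<Rightarrow> real) \<Rightarrow> real" and c
    using continuous_closedin_preimage_constant[OF that, of c] by (simp add: Collect_conj_eq vimage_def)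
  have G: "continuous_map (top_of_set ?S) Y G"
  proof (rule continuous_map_closed_cover[of "{0,1,2::nat}" _ T])
    show "closedin (top_of_set ?S) (T i)" if "i \<in> {0,1,2}" for i
    proof -
      have "{z \<in> ?S. (snd z)(m := 0) \<in> cube_boundary m} = {z \<in> ?S. cube_gauge m ((snd z)(m := 0)) = 1}"
        using bd by blast
      moreover have "continuous_on ?S (\<lambda>z. cube_gauge m ((snd z)(m := 0)))"
        by (intro continuous_on_cube_gauge continuous_on_fun_upd continuous_intros)
      ultimately show ?thesis unfolding T_def by (auto intro!: clo continuous_intros)
    qed
    show "topspace (top_of_set ?S) \<subseteq> (\<Union>i\<in>{0,1,2}. T i)"
      by (auto simp: T_def cube_boundary_Suc)
    fix i assume "i \<in> {0,1,2::nat}"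
    then consider "i = 0" | "i = 1" | "i = 2" by auto
    then show "continuous_map (subtopology (top_of_set ?S) (T i)) Y G"
    proof cases
      case 1
      have "continuous_map (top_of_set (T 0)) Y (\<lambda>z. A (fst z, (snd z)(m := 0)))"
        by (rule continuous_map_top_of_set_compose[OF A])
           (auto intro!: continuous_intros simp: T_def cube_boundary_Suc)
      then have "continuous_map (top_of_set (T 0)) Y G"
        by (rule continuous_map_eq) (auto simp: G_def T_def)
      with 1 show ?thesis by (simp add: subtopology_subtopology Int_absorb1 T_def)
    next
      case 2
      have "continuous_map (top_of_set (T 1)) Y (\<lambda>z. B (fst z, (snd z)(m := 0)))"
        by (rule continuous_map_top_of_set_compose[OF B])
           (auto intro!: continuous_intros simp: T_def cube_boundary_Suc)
      then have "continuous_map (top_of_set (T 1)) Y G"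
        by (rule continuous_map_eq) (auto simp: G_def T_def)
      with 2 show ?thesis by (simp add: subtopology_subtopology Int_absorb1 T_def)
    next
      case 3
      have "continuous_map (top_of_set (T 2)) Y (\<lambda>z. C (fst z, snd z m, (snd z)(m := 0)))"
        by (rule continuous_map_top_of_set_compose[OF C])
           (auto intro!: continuous_intros simp: T_def cube_boundary_Suc)
      then have "continuous_map (top_of_set (T 2)) Y G"
        by (rule continuous_map_eq) (auto simp: G_def T_def edge)
      with 3 show ?thesis by (simp add: subtopology_subtopology Int_absorb1 T_def)
    qed
  qed simp
  have FG: "G (0, s) = F s" if "s \<in> cube_boundary (Suc m)" for s
    using that by (auto simp: G_def F_def cube_boundary_Suc start)
  obtain E where E: "continuous_map (top_of_set (prism (Suc m))) Y E"
      "\<And>t s. t \<in> {0..1} \<Longrightarrow> s \<in> cube_boundary (Suc m) \<Longrightarrow> E (t, s) = G (t, s)"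
    using cube_homotopy_extension[OF F G FG] by metis
  define L where "L = (\<lambda>(r, s). E (1::real, s(m := r::real)))"
  show ?thesis
  proof
    show "continuous_map (top_of_set (prism m)) Y L"
      unfolding L_def split_def
      by (rule continuous_map_top_of_set_compose[OF E(1)])
         (auto intro!: continuous_intros fun_upd_in_unit_cube_Suc)
    show "L (0, s) = A (1, s)" if "s \<in> unit_cube m" for s
      using that by (simp add: L_def E(2) cube_boundary_Suc G_def unit_cube_coord_0[OF that])
    show "L (1, s) = B (1, s)" if "s \<in> unit_cube m" for s
      using that by (simp add: L_def E(2) cube_boundary_Suc G_def unit_cube_coord_0[OF that])
    show "L (r, s) = C (1, r, s)" if "r \<in> {0..1}" "s \<in> cube_boundary m" for r s
      using that subsetD[OF cube_boundary_subset that(2)]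
      by (simp add: L_def E(2) cube_boundary_Suc G_def edge)
  qed
qed

section \<open>Homotopies that move the boundary of a cube\<close>

text \<open>
  A homotopy from \<open>a\<close> to \<open>b\<close> whose restriction to the boundary is the prescribed homotopy \<open>\<beta>\<close>.
  A \<open>\<beta>\<close> that does not depend on time gives homotopy relative to the boundary.
  Such a homotopy transports the classes of cubes relative to the boundary from the boundary values
  \<open>\<beta> (0, _)\<close> to the boundary values \<open>\<beta> (1, _)\<close>; it plays the part of a change of base point.
\<close>

definition homotopic_along ::
    "nat \<Rightarrow> 'a topology \<Rightarrow> (real \<times> (nat \<Rightarrow> real) \<Rightarrow> 'a) \<Rightarrow>
      ((nat \<Rightarrow> real) \<Rightarrow> 'a) \<Rightarrow> ((nat \<Rightarrow> real) \<Rightarrow> 'a) \<Rightarrow> bool" where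
  "homotopic_along m Y \<beta> a b \<longleftrightarrow>
     (\<exists>G. continuous_map (top_of_set (prism m)) Y G \<and>
          (\<forall>s\<in>unit_cube m. G (0, s) = a s \<and> G (1, s) = b s) \<and>
          (\<forall>t\<in>{0..1}. \<forall>s\<in>cube_boundary m. G (t, s) = \<beta> (t, s)))"

lemma homotopic_alongE:
  assumes "homotopic_along m Y \<beta> a b"
  obtains G where "continuous_map (top_of_set (prism m)) Y G"
    "\<forall>s\<in>unit_cube m. G (0, s) = a s" "\<forall>s\<in>unit_cube m. G (1, s) = b s"
    "\<forall>t\<in>{0..1}. \<forall>s\<in>cube_boundary m. G (t, s) = \<beta> (t, s)"
proof -
  from assms obtain G where "continuous_map (top_of_set (prism m)) Y G"
    "\<forall>s\<in>unit_cube m. G (0, s) = a s \<and> G (1, s) = b s"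
    "\<forall>t\<in>{0..1}. \<forall>s\<in>cube_boundary m. G (t, s) = \<beta> (t, s)"
    unfolding homotopic_along_def by (elim exE conjE)
  then show thesis by (intro that[of G]) simp_all
qed

lemma homotopic_along_cong:
  assumes "homotopic_along m Y \<beta> a b"
    and "\<And>t s. t \<in> {0..1} \<Longrightarrow> s \<in> cube_boundary m \<Longrightarrow> \<beta> (t, s) = \<beta>' (t, s)"
    and "\<And>s. s \<in> unit_cube m \<Longrightarrow> a s = a' s" "\<And>s. s \<in> unit_cube m \<Longrightarrow> b s = b' s"
  shows "homotopic_along m Y \<beta>' a' b'"
proof -
  obtain G where "continuous_map (top_of_set (prism m)) Y G"
    "\<forall>s\<in>unit_cube m. G (0, s) = a s" "\<forall>s\<in>unit_cube m. G (1, s) = b s"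
    "\<forall>t\<in>{0..1}. \<forall>s\<in>cube_boundary m. G (t, s) = \<beta> (t, s)"
    by (rule homotopic_alongE[OF assms(1)])
  with assms(2-) show ?thesis unfolding homotopic_along_def by (intro exI[of _ G]) auto
qed

lemma homotopic_along_ends:
  assumes "homotopic_along m Y \<beta> a b"
  shows "continuous_map (top_of_set (unit_cube m)) Y a" "continuous_map (top_of_set (unit_cube m)) Y b"
    "\<And>s. s \<in> cube_boundary m \<Longrightarrow> a s = \<beta> (0, s)" "\<And>s. s \<in> cube_boundary m \<Longrightarrow> b s = \<beta> (1, s)"
proof -
  obtain G where G: "continuous_map (top_of_set (prism m)) Y G"
    "\<forall>s\<in>unit_cube m. G (0, s) = a s" "\<forall>s\<in>unit_cube m. G (1, s) = b s"
    "\<forall>t\<in>{0..1}. \<forall>s\<in>cube_boundary m. G (t, s) = \<beta> (t, s)"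
    by (rule homotopic_alongE[OF assms])
  have "continuous_map (top_of_set (unit_cube m)) Y (\<lambda>s. G (t, s))" if "t \<in> {0..1}" for t
    by (rule continuous_map_top_of_set_compose[OF G(1)]) (use that in \<open>auto intro!: continuous_intros\<close>)
  from continuous_map_eq[OF this[of 0], of a] continuous_map_eq[OF this[of 1], of b]
  show "continuous_map (top_of_set (unit_cube m)) Y a" "continuous_map (top_of_set (unit_cube m)) Y b"
    using G(2,3) by auto
  show "a s = \<beta> (0, s)" "b s = \<beta> (1, s)" if "s \<in> cube_boundary m" for s
    using that G(2-4) subsetD[OF cube_boundary_subset that] by auto
qed

lemma homotopic_along_refl:
  assumes "continuous_map (top_of_set (unit_cube m)) Y a"
  shows "homotopic_along m Y (\<lambda>z. a (snd z)) a a"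
  unfolding homotopic_along_def
  by (rule exI[of _ "\<lambda>z. a (snd z)"])
     (auto intro!: continuous_map_top_of_set_compose[OF assms] continuous_intros)

lemma homotopic_along_reverse:
  assumes "homotopic_along m Y \<beta> a b"
  shows "homotopic_along m Y (\<lambda>(t, s). \<beta> (1 - t, s)) b a"
proof -
  obtain G where G: "continuous_map (top_of_set (prism m)) Y G"
    "\<forall>s\<in>unit_cube m. G (0, s) = a s" "\<forall>s\<in>unit_cube m. G (1, s) = b s"
    "\<forall>t\<in>{0..1}. \<forall>s\<in>cube_boundary m. G (t, s) = \<beta> (t, s)"
    by (rule homotopic_alongE[OF assms])
  have "continuous_map (top_of_set (prism m)) Y (\<lambda>z. G (1 - fst z, snd z))"
    by (rule continuous_map_top_of_set_compose[OF G(1)]) (auto intro!: continuous_intros)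
  with G show ?thesis unfolding homotopic_along_def by (intro exI[of _ "\<lambda>z. G (1 - fst z, snd z)"]) auto
qed

lemma homotopic_along_sym:
  assumes "homotopic_along m Y (\<lambda>z. c (snd z)) a b"
  shows "homotopic_along m Y (\<lambda>z. c (snd z)) b a"
  by (rule homotopic_along_cong[OF homotopic_along_reverse[OF assms]]) auto

lemma homotopic_along_exists:
  assumes a: "continuous_map (top_of_set (unit_cube m)) Y a"
    and b: "continuous_map (top_of_set ({0..1} \<times> cube_boundary m)) Y \<beta>"
    and "\<And>s. s \<in> cube_boundary m \<Longrightarrow> \<beta> (0, s) = a s"
  obtains a' where "homotopic_along m Y \<beta> a a'"
proof -
  obtain E where "continuous_map (top_of_set (prism m)) Y E"
    "\<And>s. s \<in> unit_cube m \<Longrightarrow> E (0, s) = a s"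
    "\<And>t s. t \<in> {0..1} \<Longrightarrow> s \<in> cube_boundary m \<Longrightarrow> E (t, s) = \<beta> (t, s)"
    using cube_homotopy_extension[OF assms] by blast
  then have "homotopic_along m Y \<beta> a (\<lambda>s. E (1, s))"
    unfolding homotopic_along_def by blast
  then show ?thesis by (rule that)
qed

lemma homotopic_along_image:
  assumes "homotopic_along m Y \<beta> a b" "continuous_map Y Z f"
  shows "homotopic_along m Z (\<lambda>z. f (\<beta> z)) (\<lambda>s. f (a s)) (\<lambda>s. f (b s))"
proof -
  obtain G where G: "continuous_map (top_of_set (prism m)) Y G"
    "\<forall>s\<in>unit_cube m. G (0, s) = a s" "\<forall>s\<in>unit_cube m. G (1, s) = b s"
    "\<forall>t\<in>{0..1}. \<forall>s\<in>cube_boundary m. G (t, s) = \<beta> (t, s)"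
    by (rule homotopic_alongE[OF assms(1)])
  with continuous_map_compose[OF G(1) assms(2)] show ?thesis
    unfolding homotopic_along_def by (intro exI[of _ "f \<circ> G"]) auto
qed

text \<open>
  Transport along \<open>\<beta>\<close> respects homotopy relative to the boundary: the homotopy from \<open>a\<close> to \<open>b\<close> fills
  the prism, and pushing its ends along the given homotopies and its walls along \<open>\<beta>\<close> leads to one
  from \<open>a'\<close> to \<open>b'\<close>.
\<close>

lemma homotopic_along_transport:
  assumes "homotopic_along m Y \<beta> a a'" "homotopic_along m Y \<beta> b b'"
    and "homotopic_along m Y (\<lambda>z. \<beta> (0, snd z)) a b"
  shows "homotopic_along m Y (\<lambda>z. \<beta> (1, snd z)) a' b'"
proof -
  obtain A where A: "continuous_map (top_of_set (prism m)) Y A"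
    "\<forall>s\<in>unit_cube m. A (0, s) = a s" "\<forall>s\<in>unit_cube m. A (1, s) = a' s"
    "\<forall>t\<in>{0..1}. \<forall>s\<in>cube_boundary m. A (t, s) = \<beta> (t, s)"
    by (rule homotopic_alongE[OF assms(1)])
  obtain B where B: "continuous_map (top_of_set (prism m)) Y B"
    "\<forall>s\<in>unit_cube m. B (0, s) = b s" "\<forall>s\<in>unit_cube m. B (1, s) = b' s"
    "\<forall>t\<in>{0..1}. \<forall>s\<in>cube_boundary m. B (t, s) = \<beta> (t, s)"
    by (rule homotopic_alongE[OF assms(2)])
  obtain K where K: "continuous_map (top_of_set (prism m)) Y K"
    "\<forall>s\<in>unit_cube m. K (0, s) = a s" "\<forall>s\<in>unit_cube m. K (1, s) = b s"
    "\<forall>t\<in>{0..1}. \<forall>s\<in>cube_boundary m. K (t, s) = \<beta> (0, s)"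
    by (rule homotopic_alongE[OF assms(3), unfolded snd_conv])
  have C: "continuous_map (top_of_set ({0..1} \<times> {0..1} \<times> cube_boundary m)) Y
             (\<lambda>z. A (fst z, snd (snd z)))"
    by (rule continuous_map_top_of_set_compose[OF A(1)])
       (use cube_boundary_subset[of m] in \<open>auto intro!: continuous_intros\<close>)
  have bd: "s \<in> unit_cube m" if "s \<in> cube_boundary m" for s using cube_boundary_subset that by auto
  obtain L where "continuous_map (top_of_set (prism m)) Y L"
    "\<And>s. s \<in> unit_cube m \<Longrightarrow> L (0, s) = A (1, s)" "\<And>s. s \<in> unit_cube m \<Longrightarrow> L (1, s) = B (1, s)"
    "\<And>r s. r \<in> {0..1} \<Longrightarrow> s \<in> cube_boundary m \<Longrightarrow> L (r, s) = A (1, s)"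
    by (rule filling_deformation[OF K(1) A(1) B(1) C]) (auto simp: A B K bd)
  then show ?thesis unfolding homotopic_along_def
    by (intro exI[of _ L]) (auto simp: A B)
qed

lemma homotopic_along_transport_back:
  assumes "homotopic_along m Y \<beta> a a'" "homotopic_along m Y \<beta> b b'"
    and "homotopic_along m Y (\<lambda>z. \<beta> (1, snd z)) a' b'"
  shows "homotopic_along m Y (\<lambda>z. \<beta> (0, snd z)) a b"
  using homotopic_along_transport[OF assms(1)[THEN homotopic_along_reverse] assms(2)[THEN homotopic_along_reverse]]
    assms(3) by simp

text \<open>
  Concatenating the two homotopies would prolong \<open>\<beta>\<close> by a constant piece and so change the boundary
  values. Instead the upper end \<open>b\<close> of the first prism is deformed along the second homotopy, with the walls
  kept fixed.
\<close>

lemma homotopic_along_append: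
  assumes "homotopic_along m Y \<beta> a b" "homotopic_along m Y (\<lambda>z. \<beta> (1, snd z)) b c"
  shows "homotopic_along m Y \<beta> a c"
proof -
  obtain K where K: "continuous_map (top_of_set (prism m)) Y K"
    "\<forall>s\<in>unit_cube m. K (0, s) = a s" "\<forall>s\<in>unit_cube m. K (1, s) = b s"
    "\<forall>t\<in>{0..1}. \<forall>s\<in>cube_boundary m. K (t, s) = \<beta> (t, s)"
    by (rule homotopic_alongE[OF assms(1)])
  obtain B where B: "continuous_map (top_of_set (prism m)) Y B"
    "\<forall>s\<in>unit_cube m. B (0, s) = b s" "\<forall>s\<in>unit_cube m. B (1, s) = c s"
    "\<forall>t\<in>{0..1}. \<forall>s\<in>cube_boundary m. B (t, s) = \<beta> (1, s)"
    by (rule homotopic_alongE[OF assms(2), unfolded snd_conv])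
  have A: "continuous_map (top_of_set (prism m)) Y (\<lambda>z. K (0, snd z))"
    by (rule continuous_map_top_of_set_compose[OF K(1)]) (auto intro!: continuous_intros)
  have C: "continuous_map (top_of_set ({0..1} \<times> {0..1} \<times> cube_boundary m)) Y (\<lambda>z. K (snd z))"
    by (rule continuous_map_top_of_set_compose[OF K(1)])
       (use cube_boundary_subset[of m] in \<open>auto intro!: continuous_intros\<close>)
  have bd: "s \<in> unit_cube m" if "s \<in> cube_boundary m" for s using cube_boundary_subset that by auto
  obtain L where "continuous_map (top_of_set (prism m)) Y L"
    "\<And>s. s \<in> unit_cube m \<Longrightarrow> L (0, s) = K (0, s)" "\<And>s. s \<in> unit_cube m \<Longrightarrow> L (1, s) = B (1, s)"
    "\<And>r s. r \<in> {0..1} \<Longrightarrow> s \<in> cube_boundary m \<Longrightarrow> L (r, s) = K (r, s)"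
    by (rule filling_deformation[OF K(1) A B(1) C]) (auto simp: B K bd)
  then show ?thesis unfolding homotopic_along_def
    by (intro exI[of _ L]) (auto simp: K B)
qed

lemma homotopic_along_unique:
  assumes "homotopic_along m Y \<beta> a b" "homotopic_along m Y \<beta> a b'"
  shows "homotopic_along m Y (\<lambda>z. \<beta> (1, snd z)) b b'"
proof (rule homotopic_along_transport[OF assms])
  show "homotopic_along m Y (\<lambda>z. \<beta> (0, snd z)) a a"
    by (rule homotopic_along_cong[OF homotopic_along_refl]) (use homotopic_along_ends[OF assms(1)] in auto)
qed

lemma homotopic_along_boundary_continuous:
  assumes "homotopic_along m Y \<beta> a b"
  shows "continuous_map (top_of_set ({0..1} \<times> cube_boundary m)) Y \<beta>"
proof -
  obtain G where G: "continuous_map (top_of_set (prism m)) Y G"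
    "\<forall>t\<in>{0..1}. \<forall>s\<in>cube_boundary m. G (t, s) = \<beta> (t, s)"
    using homotopic_alongE[OF assms] by metis
  have "continuous_map (top_of_set ({0..1} \<times> cube_boundary m)) Y G"
    by (rule continuous_map_top_of_set_subset[OF G(1)]) (use cube_boundary_subset in auto)
  then show ?thesis by (rule continuous_map_eq) (use G(2) in auto)
qed


section \<open>Lifting a cube through a map\<close>

text \<open>
  A cube shrinks to its centre, and a path leads from the value there to \<open>y\<close>.
\<close>

lemma cube_null_homotopic:
  assumes "path_connected_space Y" "y \<in> topspace Y" and b: "continuous_map (top_of_set (unit_cube m)) Y b"
  obtains \<beta> where "homotopic_along m Y \<beta> b (\<lambda>_. y)"
proof -
  let ?c = "rescale m 0 (\<lambda>_. 0)"
  have c: "rescale m 0 s = ?c" for s by (auto simp: rescale_def)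
  have "?c \<in> unit_cube m" by (rule rescale_in_unit_cube) auto
  then have "b ?c \<in> topspace Y" using continuous_map_funspace[OF b] by auto
  with assms(1,2) have "\<exists>\<gamma>. pathin Y \<gamma> \<and> \<gamma> 0 = b ?c \<and> \<gamma> 1 = y"
    unfolding path_connected_space_def by blast
  then obtain \<gamma> where g: "continuous_map (top_of_set {0..1::real}) Y \<gamma>" "\<gamma> 0 = b ?c" "\<gamma> 1 = y"
    unfolding pathin_def by (elim exE conjE)
  let ?S = "prism m"
  define G where "G = (\<lambda>z. if fst z \<le> 1/2 then b (rescale m (1 - 2 * fst z) (snd z)) else \<gamma> (2 * fst z - 1))"
  have "continuous_map (top_of_set ?S) Y G"
    unfolding G_def
  proof (rule continuous_map_top_of_set_cases_le)
    show "continuous_map (top_of_set {z \<in> ?S. fst z \<le> 1/2}) Y (\<lambda>z. b (rescale m (1 - 2 * fst z) (snd z)))"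
      by (rule continuous_map_top_of_set_compose[OF b])
         (auto intro!: continuous_intros rescale_in_unit_cube mult_le_one simp: mem_unit_cube_iff_gauge cube_gauge_nonneg)
    show "continuous_map (top_of_set {z \<in> ?S. 1/2 \<le> fst z}) Y (\<lambda>z. \<gamma> (2 * fst z - 1))"
      by (rule continuous_map_top_of_set_compose[OF g(1)]) (auto intro!: continuous_intros)
    fix z assume "z \<in> ?S" and z: "fst z = 1/2"
    show "b (rescale m (1 - 2 * fst z) (snd z)) = \<gamma> (2 * fst z - 1)"
      unfolding z by (simp add: g c[of "snd z"])
  qed (auto intro!: continuous_intros)
  then have "homotopic_along m Y G b (\<lambda>_. y)"
    unfolding homotopic_along_def by (intro exI[of _ G]) (auto simp: G_def g rescale_1)
  then show ?thesis by (rule that)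
qed

text \<open>
  In terms of homotopy groups, the map induced by \<open>f\<close> in dimension \<open>m\<close> has trivial kernel. In this form
  the condition also makes sense for \<open>m = 0\<close>, where there is no group.
\<close>

definition cube_kernel_trivial :: "nat \<Rightarrow> 'a topology \<Rightarrow> 'a \<Rightarrow> 'b topology \<Rightarrow> 'b \<Rightarrow> ('a \<Rightarrow> 'b) \<Rightarrow> bool" where
  "cube_kernel_trivial m Y y Z z f \<longleftrightarrow>
     (\<forall>a. continuous_map (top_of_set (unit_cube m)) Y a \<longrightarrow> (\<forall>s\<in>cube_boundary m. a s = y) \<longrightarrow>
          homotopic_along m Z (\<lambda>_. z) (\<lambda>s. f (a s)) (\<lambda>_. z) \<longrightarrow>
          homotopic_along m Y (\<lambda>_. y) a (\<lambda>_. y))"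

definition cube_surjective :: "nat \<Rightarrow> 'a topology \<Rightarrow> 'a \<Rightarrow> 'b topology \<Rightarrow> 'b \<Rightarrow> ('a \<Rightarrow> 'b) \<Rightarrow> bool" where
  "cube_surjective m Y y Z z f \<longleftrightarrow>
     (\<forall>w. continuous_map (top_of_set (unit_cube m)) Z w \<longrightarrow> (\<forall>s\<in>cube_boundary m. w s = z) \<longrightarrow>
          (\<exists>v. continuous_map (top_of_set (unit_cube m)) Y v \<and> (\<forall>s\<in>cube_boundary m. v s = y) \<and>
               homotopic_along m Z (\<lambda>_. z) (\<lambda>s. f (v s)) w))"

text \<open>
  Trivial kernel gives injectivity for arbitrary common boundary values: a homotopy that shrinks \<open>b\<close> to
  the base point transports \<open>b\<close> to the constant map and \<open>a\<close> to a map \<open>a'\<close> that represents an element of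
  the kernel.
\<close>

lemma cube_kernel_trivial_imp_injective:
  assumes inj: "cube_kernel_trivial m Y y Z (f y) f" and f: "continuous_map Y Z f"
    and Y: "path_connected_space Y" "y \<in> topspace Y"
    and a: "continuous_map (top_of_set (unit_cube m)) Y a"
    and b: "continuous_map (top_of_set (unit_cube m)) Y b"
    and ab: "\<And>s. s \<in> cube_boundary m \<Longrightarrow> a s = b s"
    and fab: "homotopic_along m Z (\<lambda>z. f (b (snd z))) (\<lambda>s. f (a s)) (\<lambda>s. f (b s))"
  shows "homotopic_along m Y (\<lambda>z. b (snd z)) a b"
proof -
  obtain \<beta> where bb: "homotopic_along m Y \<beta> b (\<lambda>_. y)"
    using cube_null_homotopic[OF Y b] .
  note ends = homotopic_along_ends(3,4)[OF bb]
  obtain a' where aa: "homotopic_along m Y \<beta> a a'"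
    by (rule homotopic_along_exists[OF a homotopic_along_boundary_continuous[OF bb]])
       (simp add: ab ends(1))
  have "homotopic_along m Z (\<lambda>z. f (\<beta> (1, snd z))) (\<lambda>s. f (a' s)) (\<lambda>_. f y)"
    by (rule homotopic_along_transport[OF homotopic_along_image[OF aa f] homotopic_along_image[OF bb f]],
        rule homotopic_along_cong[OF fab]) (auto simp: ends(1))
  then have "homotopic_along m Z (\<lambda>_. f y) (\<lambda>s. f (a' s)) (\<lambda>_. f y)"
    by (rule homotopic_along_cong) (auto simp: ends(2)[symmetric])
  moreover have "continuous_map (top_of_set (unit_cube m)) Y a'" "\<forall>s\<in>cube_boundary m. a' s = y"
    using homotopic_along_ends(2,4)[OF aa] ends(2) by auto
  ultimately have "homotopic_along m Y (\<lambda>_. y) a' (\<lambda>_. y)"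
    using inj unfolding cube_kernel_trivial_def by blast
  then have "homotopic_along m Y (\<lambda>z. \<beta> (1, snd z)) a' (\<lambda>_. y)"
    by (rule homotopic_along_cong) (auto simp: ends(2)[symmetric])
  from homotopic_along_transport_back[OF aa bb this] show ?thesis
    by (rule homotopic_along_cong) (auto simp: ends(1))
qed

text \<open>
  Surjectivity on homotopy groups in the form with free boundary values. The map \<open>U\<close> serves only to make
  the boundary values null homotopic: shrinking \<open>U\<close> carries \<open>w\<close> to an element of the homotopy group, which
  lifts, and the lift is carried back.
\<close>

lemma cube_surjective_rel_boundary:
  assumes sur: "cube_surjective m Y y Z (f y) f" and f: "continuous_map Y Z f"
    and Y: "path_connected_space Y" "y \<in> topspace Y"
    and U: "continuous_map (top_of_set (unit_cube m)) Y U"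
    and w: "continuous_map (top_of_set (unit_cube m)) Z w"
    and fU: "\<And>s. s \<in> cube_boundary m \<Longrightarrow> w s = f (U s)"
  obtains V where "continuous_map (top_of_set (unit_cube m)) Y V"
    "\<And>s. s \<in> cube_boundary m \<Longrightarrow> V s = U s"
    "homotopic_along m Z (\<lambda>z. w (snd z)) w (\<lambda>s. f (V s))"
proof -
  obtain \<beta> where b: "homotopic_along m Y \<beta> U (\<lambda>_. y)"
    using cube_null_homotopic[OF Y U] .
  note ends = homotopic_along_ends(3,4)[OF b]
  have bc: "continuous_map (top_of_set ({0..1} \<times> cube_boundary m)) Y \<beta>"
    by (rule homotopic_along_boundary_continuous[OF b])
  obtain w' where ww: "homotopic_along m Z (\<lambda>z. f (\<beta> z)) w w'"
    by (rule homotopic_along_exists[OF w, of "\<lambda>z. f (\<beta> z)"])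
       (use continuous_map_compose[OF bc f] in \<open>auto simp: fU ends(1) o_def\<close>)
  have "\<forall>s\<in>cube_boundary m. w' s = f y"
    using homotopic_along_ends(4)[OF ww] ends(2) by auto
  then obtain v where v: "continuous_map (top_of_set (unit_cube m)) Y v" "\<forall>s\<in>cube_boundary m. v s = y"
    "homotopic_along m Z (\<lambda>_. f y) (\<lambda>s. f (v s)) w'"
    using sur homotopic_along_ends(2)[OF ww] unfolding cube_surjective_def by blast
  have "continuous_map (top_of_set ({0..1} \<times> cube_boundary m)) Y (\<lambda>z. \<beta> (1 - fst z, snd z))"
    by (rule continuous_map_top_of_set_compose[OF bc]) (auto intro!: continuous_intros)
  then obtain V where "homotopic_along m Y (\<lambda>z. \<beta> (1 - fst z, snd z)) v V"
    by (rule homotopic_along_exists[OF v(1)]) (use v(2) ends(2) in auto)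
  from homotopic_along_reverse[OF this] have VV: "homotopic_along m Y \<beta> V v"
    by (rule homotopic_along_cong) auto
  have "homotopic_along m Z (\<lambda>z. f (\<beta> (1, snd z))) (\<lambda>s. f (v s)) w'"
    by (rule homotopic_along_cong[OF v(3)]) (auto simp: ends(2)[symmetric])
  from homotopic_along_transport_back[OF homotopic_along_image[OF VV f] ww this]
  have "homotopic_along m Z (\<lambda>z. w (snd z)) (\<lambda>s. f (V s)) w"
    by (rule homotopic_along_cong) (auto simp: ends(1)[symmetric] fU)
  from homotopic_along_sym[OF this] show ?thesis
    using that homotopic_along_ends(1,3)[OF VV] ends(1) by auto
qed

text \<open>
  The vanishing of an obstruction: a sphere in \<open>Y\<close> that \<open>f\<close> maps to a sphere bounding a disc in \<open>Z\<close>
  bounds one in \<open>Y\<close>. Regard the boundary of the prism as bottom \<open>a\<close>, top \<open>b\<close> and walls \<open>\<sigma>\<close>.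
  Pushing \<open>a\<close> up along the walls gives a second top \<open>b0\<close>. Since \<open>w\<close> fills the image of the boundary,
  \<open>f \<circ> b\<close> and \<open>f \<circ> b0\<close> are homotopic relative to the boundary, and so are \<open>b\<close> and \<open>b0\<close>.
\<close>

lemma cube_boundary_map_extends:
  assumes inj: "cube_kernel_trivial m Y y Z (f y) f" and f: "continuous_map Y Z f"
    and Y: "path_connected_space Y" "y \<in> topspace Y"
    and u: "continuous_map (top_of_set (cube_boundary (Suc m))) Y u"
    and w: "continuous_map (top_of_set (unit_cube (Suc m))) Z w"
    and fu: "\<And>s. s \<in> cube_boundary (Suc m) \<Longrightarrow> w s = f (u s)"
  obtains U where "continuous_map (top_of_set (unit_cube (Suc m))) Y U"
    "\<And>s. s \<in> cube_boundary (Suc m) \<Longrightarrow> U s = u s"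
proof -
  have bd: "s \<in> unit_cube m" if "s \<in> cube_boundary m" for s using cube_boundary_subset that by auto
  define a where "a = u"
  define b where "b = (\<lambda>s. u (s(m := 1)))"
  define \<sigma> where "\<sigma> = (\<lambda>z::real \<times> (nat \<Rightarrow> real). u ((snd z)(m := fst z)))"
  have a: "continuous_map (top_of_set (unit_cube m)) Y a"
    unfolding a_def by (rule continuous_map_top_of_set_subset[OF u])
       (auto simp: cube_boundary_Suc unit_cube_coord_0)
  have b: "continuous_map (top_of_set (unit_cube m)) Y b"
    unfolding b_def by (rule continuous_map_top_of_set_compose[OF u])
       (auto intro!: continuous_intros simp: cube_boundary_Suc)
  have s: "continuous_map (top_of_set ({0..1} \<times> cube_boundary m)) Y \<sigma>"
    unfolding \<sigma>_def by (rule continuous_map_top_of_set_compose[OF u])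
       (auto intro!: continuous_intros simp: cube_boundary_Suc bd)
  have fab: "homotopic_along m Z (\<lambda>z. f (\<sigma> z)) (\<lambda>s. f (a s)) (\<lambda>s. f (b s))"
  proof -
    have "continuous_map (top_of_set (prism m)) Z (\<lambda>z. w ((snd z)(m := fst z)))"
      by (rule continuous_map_top_of_set_compose[OF w])
         (auto intro!: continuous_intros fun_upd_in_unit_cube_Suc)
    then show ?thesis unfolding homotopic_along_def
      by (intro exI[of _ "\<lambda>z. w ((snd z)(m := fst z))"])
         (auto simp: a_def b_def \<sigma>_def fu cube_boundary_Suc bd unit_cube_coord_0)
  qed
  obtain b0 where b0: "homotopic_along m Y \<sigma> a b0"
    by (rule homotopic_along_exists[OF a s]) (auto simp: \<sigma>_def a_def bd)
  have fb: "homotopic_along m Z (\<lambda>z. f (b (snd z))) (\<lambda>s. f (b0 s)) (\<lambda>s. f (b s))"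
    by (rule homotopic_along_cong[OF homotopic_along_unique[OF homotopic_along_image[OF b0 f] fab]])
       (auto simp: b_def \<sigma>_def)
  have "homotopic_along m Y (\<lambda>z. b (snd z)) b0 b"
    by (rule cube_kernel_trivial_imp_injective[OF inj f Y homotopic_along_ends(2)[OF b0] b _ fb])
       (auto simp: homotopic_along_ends(4)[OF b0] b_def \<sigma>_def)
  then have "homotopic_along m Y (\<lambda>z. \<sigma> (1, snd z)) b0 b"
    by (rule homotopic_along_cong) (auto simp: b_def \<sigma>_def)
  from homotopic_along_append[OF b0 this]
  obtain G where G: "continuous_map (top_of_set (prism m)) Y G"
    "\<forall>s\<in>unit_cube m. G (0, s) = a s" "\<forall>s\<in>unit_cube m. G (1, s) = b s"
    "\<forall>t\<in>{0..1}. \<forall>s\<in>cube_boundary m. G (t, s) = \<sigma> (t, s)"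
    by (rule homotopic_alongE)
  show ?thesis
  proof
    show "continuous_map (top_of_set (unit_cube (Suc m))) Y (\<lambda>t. G (t m, t(m := 0)))"
      by (rule continuous_map_top_of_set_compose[OF G(1) continuous_on_Pair[OF
          continuous_on_coord[OF continuous_on_id] continuous_on_fun_upd[OF continuous_on_id continuous_on_const]]])
         (auto simp: unit_cube_Suc)
    fix s assume s: "s \<in> cube_boundary (Suc m)"
    then consider "s m = 0" "s(m := 0) \<in> unit_cube m" | "s m = 1" "s(m := 0) \<in> unit_cube m"
      | "s m \<in> {0..1}" "s(m := 0) \<in> cube_boundary m"
      by (auto simp: cube_boundary_Suc)
    then show "G (s m, s(m := 0)) = u s"
    proof cases
      case 1 then have "s(m := 0) = s" by auto
      with 1 show ?thesis using G(2) by (metis a_def)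
    next
      case 2 then have "s(m := 1) = s" by auto
      with 2 show ?thesis using G(3) by (simp add: b_def)
    qed (simp add: G(4) \<sigma>_def)
  qed
qed

text \<open>
  The step over one cell. The homotopy \<open>\<beta>\<close> first carries \<open>w\<close> to a map that agrees on the boundary with
  \<open>f \<circ> u\<close>. Injectivity in dimension \<open>k - 1\<close> makes \<open>u\<close> extend over the cube, and surjectivity in
  dimension \<open>k\<close> corrects the extension so that its image becomes homotopic to the map reached from \<open>w\<close>.
\<close>

lemma cube_lifting:
  assumes inj: "\<And>m. k = Suc m \<Longrightarrow> cube_kernel_trivial m Y y Z (f y) f"
    and sur: "cube_surjective k Y y Z (f y) f" and f: "continuous_map Y Z f"
    and Y: "path_connected_space Y" "y \<in> topspace Y"
    and u: "continuous_map (top_of_set (cube_boundary k)) Y u"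
    and w: "continuous_map (top_of_set (unit_cube k)) Z w"
    and b: "continuous_map (top_of_set ({0..1} \<times> cube_boundary k)) Z \<beta>"
    and start: "\<And>s. s \<in> cube_boundary k \<Longrightarrow> \<beta> (0, s) = w s"
    and stop: "\<And>s. s \<in> cube_boundary k \<Longrightarrow> \<beta> (1, s) = f (u s)"
  obtains V where "continuous_map (top_of_set (unit_cube k)) Y V"
    "\<And>s. s \<in> cube_boundary k \<Longrightarrow> V s = u s"
    "homotopic_along k Z \<beta> w (\<lambda>s. f (V s))"
proof -
  obtain w' where w': "homotopic_along k Z \<beta> w w'"
    by (rule homotopic_along_exists[OF w b start])
  have fu: "w' s = f (u s)" if "s \<in> cube_boundary k" for s
    using homotopic_along_ends(4)[OF w' that] stop that by simp
  obtain U where U: "continuous_map (top_of_set (unit_cube k)) Y U"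
    "\<And>s. s \<in> cube_boundary k \<Longrightarrow> U s = u s"
  proof (cases k)
    case 0
    \<comment> \<open>The boundary of the 0-cube is empty, so any map will do.\<close>
    then show ?thesis using that[of "\<lambda>_. y"] Y(2) by simp
  next
    case (Suc m)
    from cube_boundary_map_extends[OF inj[OF Suc] f Y] u homotopic_along_ends(2)[OF w'] fu
    show ?thesis unfolding Suc by (metis that Suc)
  qed
  obtain V where V: "continuous_map (top_of_set (unit_cube k)) Y V"
    "\<And>s. s \<in> cube_boundary k \<Longrightarrow> V s = U s"
    "homotopic_along k Z (\<lambda>z. w' (snd z)) w' (\<lambda>s. f (V s))"
    by (rule cube_surjective_rel_boundary[OF sur f Y U(1) homotopic_along_ends(2)[OF w']])
       (auto simp: fu U(2))
  have "homotopic_along k Z \<beta> w (\<lambda>s. f (V s))"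
    by (rule homotopic_along_append[OF w'], rule homotopic_along_cong[OF V(3)])
       (auto simp: fu stop)
  then show ?thesis using that V(1,2) U(2) by metis
qed


section \<open>Cubes and discs\<close>

lemma disc_eq: "disc k = top_of_set {t. (\<forall>j\<ge>k. t j = 0) \<and> L2_set t {..<k} \<le> 1}"
  unfolding disc_def Euclidean_space_eq subtopology_subtopology
  by (rule arg_cong[of _ _ top_of_set]) (auto simp: L2_set_def)

lemma topspace_disc: "topspace (disc k) = {t. (\<forall>j\<ge>k. t j = 0) \<and> L2_set t {..<k} \<le> 1}"
  by (simp add: disc_eq)

lemma disc_interior_eq: "disc_interior k = {t. (\<forall>j\<ge>k. t j = 0) \<and> L2_set t {..<k} < 1}"
  by (auto simp: disc_interior_def topspace_disc L2_set_def)

lemma disc_boundary_eq: "disc_boundary k = {t. (\<forall>j\<ge>k. t j = 0) \<and> L2_set t {..<k} = 1}"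
  by (auto simp: disc_boundary_def topspace_disc L2_set_def)

lemma cube_gauge_cong: "(\<And>j. j < m \<Longrightarrow> t j = t' j) \<Longrightarrow> cube_gauge m t = cube_gauge m t'"
  by (induction m) auto

text \<open>
  The maximum norm on the first \<open>k\<close> coordinates, written as the gauge of the point of the unit cube that
  corresponds to \<open>v\<close>.
\<close>

definition max_norm :: "nat \<Rightarrow> (nat \<Rightarrow> real) \<Rightarrow> real" where
  "max_norm k v = cube_gauge k (\<lambda>j. 1/2 + v j / 2)"

lemma max_norm_nonneg: "0 \<le> max_norm k v"
  by (simp add: max_norm_def cube_gauge_nonneg)

lemma max_norm_coord_le: "j < k \<Longrightarrow> \<bar>v j\<bar> \<le> max_norm k v"
  using cube_gauge_coord_le[of j k "\<lambda>j. 1/2 + v j / 2"] by (simp add: max_norm_def)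

lemma max_norm_scale: "0 \<le> r \<Longrightarrow> max_norm k (\<lambda>j. v j * r) = max_norm k v * r"
proof (induction k)
  case (Suc k)
  then show ?case by (simp add: max_norm_def abs_mult max_mult_distrib_right)
qed (simp add: max_norm_def)

lemma max_norm_0: "(\<And>j. j < k \<Longrightarrow> v j = 0) \<Longrightarrow> max_norm k v = 0"
  by (induction k) (auto simp: max_norm_def)

text \<open>
  Stretching along rays carries the unit ball of a norm \<open>p\<close> onto that of a norm \<open>q\<close>.
  At the origin the quotient is \<open>0 / 0 = 0\<close>, which is harmless because \<open>v\<close> is 0 there.
\<close>

definition radial :: "((nat \<Rightarrow> real) \<Rightarrow> real) \<Rightarrow> ((nat \<Rightarrow> real) \<Rightarrow> real) \<Rightarrow> (nat \<Rightarrow> real) \<Rightarrow> nat \<Rightarrow> real" where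
  "radial p q v = (\<lambda>j. v j * (p v / q v))"

lemma radial_gauge:
  assumes "\<And>r v. 0 \<le> r \<Longrightarrow> q (\<lambda>j. v j * r) = q v * r" "0 \<le> p v" "0 \<le> q v" "q v = 0 \<Longrightarrow> p v = 0"
  shows "q (radial p q v) = p v"
proof -
  have "q (radial p q v) = q v * (p v / q v)"
    unfolding radial_def by (rule assms(1)) (use assms(2,3) in simp)
  then show ?thesis using assms(4) by auto
qed

lemma radial_inverse:
  assumes q: "\<And>r v. 0 \<le> r \<Longrightarrow> q (\<lambda>j. v j * r) = q v * r" and p: "\<And>r v. 0 \<le> r \<Longrightarrow> p (\<lambda>j. v j * r) = p v * r"
    and "0 \<le> p v" "0 \<le> q v" "q v = 0 \<longleftrightarrow> p v = 0" "q v = 0 \<Longrightarrow> v = (\<lambda>_. 0)"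
  shows "radial q p (radial p q v) = v"
proof (cases "q v = 0")
  case True
  then show ?thesis using assms(6) by (simp add: radial_def)
next
  case False
  have "p (radial p q v) = p v * (p v / q v)"
    unfolding radial_def using p[of "p v / q v" v] assms(3,4) by simp
  moreover have "q (radial p q v) = p v"
    by (rule radial_gauge[of q, OF q]) (use assms in auto)
  ultimately show ?thesis
    using False assms(5) by (simp add: radial_def[of q] fun_eq_iff) (simp add: radial_def)
qed

lemma continuous_on_radial_coord:
  fixes S :: "(nat \<Rightarrow> real) set"
  assumes p: "continuous_on S p" and q: "continuous_on S q" and nn: "\<And>v. 0 \<le> p v" "\<And>v. 0 \<le> q v"
    and le: "\<And>v. v \<in> S \<Longrightarrow> \<bar>v j\<bar> \<le> q v" and z: "\<And>v. v \<in> S \<Longrightarrow> q v = 0 \<Longrightarrow> p v = 0"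
  shows "continuous_on S (\<lambda>v. radial p q v j)"
  unfolding continuous_on_def
proof
  fix v assume v: "v \<in> S"
  have pt: "(p \<longlongrightarrow> p v) (at v within S)" and qt: "(q \<longlongrightarrow> q v) (at v within S)"
    using p q v by (auto simp: continuous_on_def)
  show "((\<lambda>v. radial p q v j) \<longlongrightarrow> radial p q v j) (at v within S)"
  proof (cases "q v = 0")
    case True
    \<comment> \<open>At the origin the quotient need not have a limit, but the product is dominated by \<open>p\<close>.\<close>
    have "\<bar>u j * (p u / q u)\<bar> \<le> p u" if "u \<in> S" for u
    proof (cases "q u = 0")
      case False
      then have "\<bar>u j * (p u / q u)\<bar> = \<bar>u j\<bar> / q u * p u" using nn[of u] by (simp add: abs_mult)
      also have "\<dots> \<le> 1 * p u"
        using le[OF that] False nn[of u] by (intro mult_right_mono) (auto simp: divide_le_eq_1)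
      finally show ?thesis by simp
    qed (simp add: nn)
    then have "\<forall>\<^sub>F u in at v within S. norm (u j * (p u / q u)) \<le> p u"
      by (auto simp: eventually_at_filter)
    moreover have "(p \<longlongrightarrow> 0) (at v within S)" using pt z[OF v True] by simp
    ultimately have "((\<lambda>u. u j * (p u / q u)) \<longlongrightarrow> 0) (at v within S)"
      by (rule Lim_null_comparison)
    then show ?thesis using True by (simp add: radial_def)
  next
    case False
    have "((\<lambda>u. u j) \<longlongrightarrow> v j) (at v within S)"
      using continuous_on_coord[OF continuous_on_id[of S], of j] v by (auto simp: continuous_on_def)
    then show ?thesis unfolding radial_def by (intro tendsto_intros pt qt False)
  qed
qed

text \<open>
  Homotopy groups are built from cubes and cells from discs; the radial stretching between the unit balls
  of the maximum norm and of the Euclidean norm identifies the two, boundaries included.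
\<close>

lemma cube_disc_homeomorphism:
  obtains \<phi> where "continuous_on (unit_cube k) \<phi>" "\<phi> \<in> unit_cube k \<rightarrow> topspace (disc k)"
    "inj_on \<phi> (unit_cube k)" "\<phi> ` unit_cube k = topspace (disc k)"
    "\<phi> ` cube_boundary k = disc_boundary k"
    "\<phi> ` (unit_cube k - cube_boundary k) = disc_interior k"
proof -
  let ?p = "max_norm k" and ?q = "\<lambda>v. L2_set v {..<k}"
  define R where "R = {v::nat \<Rightarrow> real. \<forall>j\<ge>k. v j = 0}"
  define c where "c = (\<lambda>(t::nat \<Rightarrow> real) j. if j < k then 2 * t j - 1 else 0)"
  define c' where "c' = (\<lambda>(v::nat \<Rightarrow> real) j. if j < k then 1/2 + v j / 2 else 0)"
  define \<phi> where "\<phi> = (\<lambda>t. radial ?p ?q (c t))"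
  have q_scale: "?q (\<lambda>j. v j * r) = ?q v * r" if "0 \<le> r" for r v
    using that by (simp add: L2_set_left_distrib)
  have p0: "?p v = 0 \<longleftrightarrow> (\<forall>j<k. v j = 0)" for v
    using max_norm_0[of k v] max_norm_coord_le[of _ k v] by fastforce
  have q0: "?q v = 0 \<longleftrightarrow> (\<forall>j<k. v j = 0)" for v by (auto simp: L2_set_eq_0_iff)
  have R0: "v = (\<lambda>_. 0)" if "v \<in> R" "\<forall>j<k. v j = 0" for v
    using that by (auto simp: R_def fun_eq_iff not_less[symmetric])
  have cR: "c t \<in> R" for t by (simp add: c_def R_def)
  have pc: "?p (c t) = cube_gauge k t" for t
    unfolding max_norm_def by (rule cube_gauge_cong) (simp add: c_def field_simps)
  have cc: "c' (c t) = t" if "t \<in> unit_cube k" for t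
    using that by (auto simp: c_def c'_def unit_cube_def fun_eq_iff field_simps)
  have cc': "c (c' v) = v" if "v \<in> R" for v
    using that by (auto simp: c_def c'_def R_def fun_eq_iff field_simps)
  have radR: "radial p q v \<in> R" if "v \<in> R" for p q v using that by (simp add: radial_def R_def)
  have q\<phi>: "?q (\<phi> t) = cube_gauge k t" for t
    unfolding \<phi>_def pc[symmetric]
    by (rule radial_gauge[of ?q, OF q_scale]) (auto simp: max_norm_nonneg p0 q0)
  have \<phi>R: "\<phi> t \<in> R" for t unfolding \<phi>_def by (intro radR cR)
  have inv1: "radial ?q ?p (radial ?p ?q v) = v" if "v \<in> R" for v
    by (rule radial_inverse[of ?q, OF q_scale]) (use that R0 in \<open>auto simp: max_norm_scale max_norm_nonneg p0 q0\<close>)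
  have inv2: "radial ?p ?q (radial ?q ?p v) = v" if "v \<in> R" for v
    by (rule radial_inverse[of ?p, OF max_norm_scale]) (use that R0 in \<open>auto simp: q_scale max_norm_nonneg p0 q0\<close>)
  have onto: "\<exists>t. (\<forall>j\<ge>k. t j = 0) \<and> cube_gauge k t = ?q v \<and> \<phi> t = v" if v: "v \<in> R" for v
  proof (intro exI conjI)
    let ?t = "c' (radial ?q ?p v)"
    show "\<phi> ?t = v" unfolding \<phi>_def cc'[OF radR[OF v]] by (rule inv2[OF v])
    then show "cube_gauge k ?t = ?q v" using q\<phi>[of ?t] by simp
  qed (simp add: c'_def)
  have img: "\<phi> ` {t. (\<forall>j\<ge>k. t j = 0) \<and> Q (cube_gauge k t)} = {v. (\<forall>j\<ge>k. v j = 0) \<and> Q (?q v)}" (is "_ ` ?A = ?B") for Q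
  proof
    show "\<phi> ` ?A \<subseteq> ?B" using \<phi>R q\<phi> by (auto simp: R_def)
    show "?B \<subseteq> \<phi> ` ?A"
    proof
      fix v assume "v \<in> ?B"
      then obtain t where "\<forall>j\<ge>k. t j = 0" "cube_gauge k t = ?q v" "\<phi> t = v"
        using onto[of v] by (auto simp: R_def)
      with \<open>v \<in> ?B\<close> show "v \<in> \<phi> ` ?A" by (intro image_eqI[of _ _ t]) auto
    qed
  qed
  have cube: "unit_cube k = {t. (\<forall>j\<ge>k. t j = 0) \<and> cube_gauge k t \<le> 1}"
    "cube_boundary k = {t. (\<forall>j\<ge>k. t j = 0) \<and> cube_gauge k t = 1}"
    "unit_cube k - cube_boundary k = {t. (\<forall>j\<ge>k. t j = 0) \<and> cube_gauge k t < 1}"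
    using mem_unit_cube_iff_gauge mem_cube_boundary_iff_gauge by (auto simp: order_less_le)
  have c: "continuous_on (unit_cube k) c"
    unfolding c_def
  proof (rule continuous_on_coordinatewise_then_product)
    show "continuous_on (unit_cube k) (\<lambda>t. if j < k then 2 * t j - 1 else 0)" for j
      by (cases "j < k") (auto intro!: continuous_intros continuous_on_coord[OF continuous_on_id])
  qed
  have rad: "continuous_on R (\<lambda>v. radial ?p ?q v)"
  proof (rule continuous_on_coordinatewise_then_product)
    fix j
    have coord: "continuous_on R (\<lambda>v. v i)" for i
      by (rule continuous_on_coord[OF continuous_on_id])
    show "continuous_on R (\<lambda>v. radial ?p ?q v j)"
    proof (rule continuous_on_radial_coord)
      have "continuous_on R (\<lambda>(v::nat \<Rightarrow> real) j. 1/2 + v j / 2)"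
        by (intro continuous_on_coordinatewise_then_product continuous_intros coord) auto
      then show "continuous_on R ?p" unfolding max_norm_def by (rule continuous_on_cube_gauge)
      show "continuous_on R ?q" unfolding L2_set_def by (intro continuous_intros coord)
      show "\<bar>v j\<bar> \<le> ?q v" if "v \<in> R" for v
      proof (cases "j < k")
        case True
        then have "(v j)\<^sup>2 \<le> (\<Sum>i<k. (v i)\<^sup>2)" by (intro member_le_sum) auto
        then show ?thesis unfolding L2_set_def by (simp add: real_le_rsqrt)
      qed (use that in \<open>auto simp: R_def\<close>)
    qed (auto simp: max_norm_nonneg p0 q0)
  qed
  have "continuous_on (unit_cube k) \<phi>"
    unfolding \<phi>_def by (rule continuous_on_compose2[OF rad c]) (use cR in auto)
  moreover have "inj_on \<phi> (unit_cube k)"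
    by (rule inj_on_inverseI[of _ "\<lambda>v. c' (radial ?q ?p v)"]) (simp add: \<phi>_def inv1[OF cR] cc)
  moreover have "\<phi> ` unit_cube k = topspace (disc k)" "\<phi> ` cube_boundary k = disc_boundary k"
    "\<phi> ` (unit_cube k - cube_boundary k) = disc_interior k"
    unfolding cube(3) unfolding cube(1,2) topspace_disc disc_boundary_eq disc_interior_eq by (rule img)+
  moreover from this have "\<phi> \<in> unit_cube k \<rightarrow> topspace (disc k)" by blast
  ultimately show ?thesis by (intro that)
qed

lemma unit_cube_compact_path_connected:
  shows compact_unit_cube: "compact (unit_cube m)"
    and path_connected_unit_cube: "path_connected (unit_cube m)"
proof -
  have *:  "unit_cube m = PiE UNIV (\<lambda>j. if j < m then {0..1} else {0})"
    by (auto simp: unit_cube_def PiE_iff not_less split: if_splits) (metis not_less)+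
  have "compactin (product_topology (\<lambda>_. euclideanreal) UNIV) (PiE UNIV (\<lambda>j. if j < m then {0..1} else {0}))"
    by (auto simp: compactin_PiE)
  then show "compact (unit_cube m)" by (simp add: * euclidean_product_topology)
  have "path_connectedin (product_topology (\<lambda>_. euclideanreal) UNIV) (PiE UNIV (\<lambda>j. if j < m then {0..1} else {0}))"
    by (auto simp: path_connectedin_PiE)
  then show "path_connected (unit_cube m)" by (simp add: * euclidean_product_topology)
qed

section \<open>Cell complexes with cubical cells\<close>

text \<open>
  A CW-complex whose characteristic maps are defined on cubes. Since homotopy groups are built from
  cubes, this makes the lifting lemma for cubes directly applicable to the cells.
\<close>

locale cubical_complex =
  fixes X :: "'a topology" and J :: "'j set" and d :: "'j \<Rightarrow> nat" and \<psi> :: "'j \<Rightarrow> (nat \<Rightarrow> real) \<Rightarrow> 'a"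
  assumes Hausdorff: "Hausdorff_space X"
    and continuous_char: "j \<in> J \<Longrightarrow> continuous_map (top_of_set (unit_cube (d j))) X (\<psi> j)"
    and inj_char: "j \<in> J \<Longrightarrow> inj_on (\<psi> j) (unit_cube (d j) - cube_boundary (d j))"
    and disjoint_cells: "disjoint_family_on (\<lambda>j. \<psi> j ` (unit_cube (d j) - cube_boundary (d j))) J"
    and cells_cover: "(\<Union>j\<in>J. \<psi> j ` (unit_cube (d j) - cube_boundary (d j))) = topspace X"
    and closure_finite: "j \<in> J \<Longrightarrow> \<exists>F. finite F \<and> F \<subseteq> J \<and> (\<forall>i\<in>F. d i < d j) \<and>
            \<psi> j ` cube_boundary (d j) \<subseteq> (\<Union>i\<in>F. \<psi> i ` (unit_cube (d i) - cube_boundary (d i)))"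
    and weak_topology: "S \<subseteq> topspace X \<Longrightarrow> (\<And>j. j \<in> J \<Longrightarrow> closedin X (S \<inter> \<psi> j ` unit_cube (d j))) \<Longrightarrow> closedin X S"

lemma CW_complex_imp_cubical_complex:
  assumes "CW_complex X J d \<Phi>"
  obtains \<psi> where "cubical_complex X J d \<psi>"
    "\<And>j. j \<in> J \<Longrightarrow> \<psi> j ` (unit_cube (d j) - cube_boundary (d j)) = \<Phi> j ` disc_interior (d j)"
proof -
  have "\<forall>k. \<exists>\<phi>. continuous_on (unit_cube k) \<phi> \<and> \<phi> \<in> unit_cube k \<rightarrow> topspace (disc k) \<and>
    inj_on \<phi> (unit_cube k) \<and> \<phi> ` unit_cube k = topspace (disc k) \<and> \<phi> ` cube_boundary k = disc_boundary k \<and>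
    \<phi> ` (unit_cube k - cube_boundary k) = disc_interior k"
    by (intro allI, rule cube_disc_homeomorphism) blast
  then obtain \<phi> where \<phi>: "\<And>k. continuous_on (unit_cube k) (\<phi> k)" "\<And>k. \<phi> k \<in> unit_cube k \<rightarrow> topspace (disc k)"
    "\<And>k. inj_on (\<phi> k) (unit_cube k)" "\<And>k. \<phi> k ` unit_cube k = topspace (disc k)"
    "\<And>k. \<phi> k ` cube_boundary k = disc_boundary k"
    "\<And>k. \<phi> k ` (unit_cube k - cube_boundary k) = disc_interior k"
    by metis
  define \<psi> where "\<psi> = (\<lambda>j s. \<Phi> j (\<phi> (d j) s))"
  have closed: "\<psi> j ` unit_cube (d j) = \<Phi> j ` topspace (disc (d j))"
    and opn: "\<psi> j ` (unit_cube (d j) - cube_boundary (d j)) = \<Phi> j ` disc_interior (d j)"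
    and bdry: "\<psi> j ` cube_boundary (d j) = \<Phi> j ` disc_boundary (d j)" for j
    unfolding \<psi>_def \<phi>(4-6)[symmetric] by (simp_all add: image_image)
  note CW = assms[unfolded CW_complex_def]
  have "cubical_complex X J d \<psi>"
  proof
    fix j assume j: "j \<in> J"
    have "continuous_map (disc (d j)) X (\<Phi> j)" using CW j by blast
    then show "continuous_map (top_of_set (unit_cube (d j))) X (\<psi> j)"
      unfolding \<psi>_def disc_eq
      by (rule continuous_map_top_of_set_compose[OF _ \<phi>(1)]) (use \<phi>(2)[of "d j"] in \<open>simp add: topspace_disc\<close>)
    have "embedding_map (subtopology (disc (d j)) (disc_interior (d j))) X (\<Phi> j)" using CW j by blast
    then have "inj_on (\<Phi> j) (topspace (subtopology (disc (d j)) (disc_interior (d j))))"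
      unfolding embedding_map_def by (rule homeomorphic_imp_injective_map)
    moreover have "topspace (subtopology (disc (d j)) (disc_interior (d j))) = disc_interior (d j)"
      by (auto simp: disc_interior_def)
    ultimately have "inj_on (\<Phi> j) (\<phi> (d j) ` (unit_cube (d j) - cube_boundary (d j)))" by (simp add: \<phi>(6))
    moreover have "inj_on (\<phi> (d j)) (unit_cube (d j) - cube_boundary (d j))"
      by (rule inj_on_subset[OF \<phi>(3)]) auto
    ultimately show "inj_on (\<psi> j) (unit_cube (d j) - cube_boundary (d j))"
      using comp_inj_on unfolding \<psi>_def o_def by blast
    show "\<exists>F. finite F \<and> F \<subseteq> J \<and> (\<forall>i\<in>F. d i < d j) \<and>
            \<psi> j ` cube_boundary (d j) \<subseteq> (\<Union>i\<in>F. \<psi> i ` (unit_cube (d i) - cube_boundary (d i)))"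
      unfolding opn bdry using CW j by blast
  qed (use CW in \<open>simp_all add: opn closed\<close>)
  with opn show ?thesis by (intro that)
qed

context cubical_complex
begin

definition "open_cell j = \<psi> j ` (unit_cube (d j) - cube_boundary (d j))"

definition "closed_cell j = \<psi> j ` unit_cube (d j)"

lemma closed_cell_compact: "j \<in> J \<Longrightarrow> compactin X (closed_cell j)"
  unfolding closed_cell_def
  by (rule image_compactin[OF _ continuous_char]) (auto simp: compactin_subtopology compact_unit_cube)

lemma closed_cell_closed: "j \<in> J \<Longrightarrow> closedin X (closed_cell j)"
  by (simp add: compactin_imp_closedin Hausdorff closed_cell_compact)

lemma char_in_topspace: "j \<in> J \<Longrightarrow> s \<in> unit_cube (d j) \<Longrightarrow> \<psi> j s \<in> topspace X"
  using continuous_map_funspace[OF continuous_char] by auto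

lemma continuous_map_char_prism:
  assumes "j \<in> J" "S \<subseteq> prism (d j)"
  shows "continuous_map (top_of_set S) (prod_topology (top_of_set {0..1}) X) (\<lambda>z. (fst z, \<psi> j (snd z)))"
proof (rule continuous_map_pairedI)
  show "continuous_map (top_of_set S) (top_of_set {0..1}) fst"
    using assms(2) by (auto intro!: continuous_intros)
  show "continuous_map (top_of_set S) X (\<lambda>z. \<psi> j (snd z))"
    by (rule continuous_map_top_of_set_compose[OF continuous_char[OF assms(1)]])
       (use assms(2) in \<open>auto intro!: continuous_intros\<close>)
qed

text \<open>
  The closed cell is compact and the complex is Hausdorff, so that the characteristic map times the
  interval is a quotient map onto the cylinder over the closed cell.
\<close>

lemma homotopy_continuous_on_closed_cell:
  assumes j: "j \<in> J" and H: "continuous_map (top_of_set (prism (d j))) Z (\<lambda>z. H (fst z, \<psi> j (snd z)))"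
  shows "continuous_map (subtopology (prod_topology (top_of_set {0..1}) X) ({0..1} \<times> closed_cell j)) Z H"
proof (rule continuous_compose_quotient_map)
  let ?q = "\<lambda>z. (fst z, \<psi> j (snd z))"
  let ?P = "prod_topology (top_of_set {0..1::real}) X"
  show "quotient_map (top_of_set (prism (d j))) (subtopology ?P ({0..1} \<times> closed_cell j)) ?q"
  proof (rule continuous_imp_quotient_map)
    show "continuous_map (top_of_set (prism (d j))) (subtopology ?P ({0..1} \<times> closed_cell j)) ?q"
      using continuous_map_char_prism[OF j subset_refl]
      by (auto simp: continuous_map_in_subtopology closed_cell_def)
    show "compact_space (top_of_set (prism (d j)))"
      by (simp add: compact_space_subtopology compact_Times compact_unit_cube)
    have "Hausdorff_space ?P" by (simp add: Hausdorff_space_prod_topology Hausdorff Hausdorff_space_subtopology)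
    then show "Hausdorff_space (subtopology ?P ({0..1} \<times> closed_cell j))" by (rule Hausdorff_space_subtopology)
    show "?q ` topspace (top_of_set (prism (d j))) = topspace (subtopology ?P ({0..1} \<times> closed_cell j))"
      using char_in_topspace[OF j] by (force simp: closed_cell_def)
  qed
  show "continuous_map (top_of_set (prism (d j))) Z (H \<circ> ?q)" using H by (simp add: o_def)
qed

text \<open>
  By closure-finiteness finitely many closed cells of smaller dimension cover the image of the boundary;
  their preimages form a finite closed cover of the boundary.
\<close>

lemma homotopy_continuous_on_boundary:
  assumes j: "j \<in> J" and H: "\<And>i. i \<in> J \<Longrightarrow> d i < d j \<Longrightarrow>
      continuous_map (top_of_set (prism (d i))) Z (\<lambda>z. H (fst z, \<psi> i (snd z)))"
  shows "continuous_map (top_of_set ({0..1} \<times> cube_boundary (d j))) Z (\<lambda>z. H (fst z, \<psi> j (snd z)))"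
proof -
  from closure_finite[OF j] obtain F where F: "finite F" "F \<subseteq> J" "\<forall>i\<in>F. d i < d j"
    and "\<psi> j ` cube_boundary (d j) \<subseteq> (\<Union>i\<in>F. \<psi> i ` (unit_cube (d i) - cube_boundary (d i)))"
    by (elim exE conjE)
  moreover have "(\<Union>i\<in>F. \<psi> i ` (unit_cube (d i) - cube_boundary (d i))) \<subseteq> (\<Union>i\<in>F. closed_cell i)"
    unfolding closed_cell_def by (intro UN_mono image_mono) auto
  ultimately have bd: "\<psi> j ` cube_boundary (d j) \<subseteq> (\<Union>i\<in>F. closed_cell i)" by (rule_tac subset_trans)
  let ?S = "{0..1} \<times> cube_boundary (d j) :: (real \<times> (nat \<Rightarrow> real)) set"
  let ?q = "\<lambda>z. (fst z, \<psi> j (snd z))"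
  have q: "continuous_map (top_of_set ?S) (prod_topology (top_of_set {0..1}) X) ?q"
    by (rule continuous_map_char_prism[OF j]) (use cube_boundary_subset in auto)
  from continuous_map_compose[OF this continuous_map_snd]
  have c: "continuous_map (top_of_set ?S) X (\<lambda>z. \<psi> j (snd z))" by (simp add: o_def)
  show ?thesis
  proof (rule continuous_map_closed_cover[OF F(1)])
    fix i assume i: "i \<in> F"
    let ?B = "{z \<in> topspace (top_of_set ?S). \<psi> j (snd z) \<in> closed_cell i}"
    show "closedin (top_of_set ?S) ?B"
      by (rule closedin_continuous_map_preimage[OF c]) (use closed_cell_closed i F in auto)
    have "continuous_map (subtopology (top_of_set ?S) ?B)
            (subtopology (prod_topology (top_of_set {0..1}) X) ({0..1} \<times> closed_cell i)) ?q"
      by (auto simp: continuous_map_in_subtopology continuous_map_from_subtopology[OF q])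
    moreover have "continuous_map (subtopology (prod_topology (top_of_set {0..1}) X) ({0..1} \<times> closed_cell i)) Z H"
      using i F by (intro homotopy_continuous_on_closed_cell H) auto
    ultimately have "continuous_map (subtopology (top_of_set ?S) ?B) Z (H \<circ> ?q)"
      by (rule continuous_map_compose)
    then show "continuous_map (subtopology (top_of_set ?S) ?B) Z (\<lambda>z. H (fst z, \<psi> j (snd z)))"
      by (simp add: o_def)
  next
    show "topspace (top_of_set ?S) \<subseteq> (\<Union>i\<in>F. {z \<in> topspace (top_of_set ?S). \<psi> j (snd z) \<in> closed_cell i})"
      using bd by fastforce
  qed
qed

text \<open>
  The cylinder over a complex carries the weak topology of the cylinders over the cells, because the
  interval is locally compact. Concretely, let \<open>H (t, y)\<close> lie in the open set \<open>W\<close>, and let \<open>N\<close> be a compact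
  neighbourhood of \<open>t\<close> with \<open>H (N \<times> {y}) \<subseteq> W\<close>. The points \<open>p\<close> with \<open>H (N \<times> {p}) \<subseteq> W\<close> form an open
  set: within each closed cell the other points are the projection of a compact set.
\<close>

lemma homotopy_continuous:
  assumes H: "\<And>j. j \<in> J \<Longrightarrow> continuous_map (top_of_set (prism (d j))) Z (\<lambda>z. H (fst z, \<psi> j (snd z)))"
  shows "continuous_map (prod_topology (top_of_set {0..1}) X) Z H"
proof -
  have cover: "\<exists>j\<in>J. \<exists>s\<in>unit_cube (d j). y = \<psi> j s" if "y \<in> topspace X" for y
    using that unfolding cells_cover[symmetric] by blast
  have im: "H (t, y) \<in> topspace Z" if ty: "t \<in> {0..1}" "y \<in> topspace X" for t y
  proof -
    obtain j s where "j \<in> J" "s \<in> unit_cube (d j)" "y = \<psi> j s" using cover[OF ty(2)] by auto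
    with funcset_mem[OF continuous_map_funspace[OF H[of j]], of "(t, s)"] ty(1) show ?thesis by simp
  qed
  have "openin (prod_topology (top_of_set {0..1}) X) {z \<in> {0..1} \<times> topspace X. H z \<in> W}" (is "openin _ ?W")
    if W: "openin Z W" for W
    unfolding openin_prod_topology_alt
  proof (intro allI impI)
    fix t y assume "(t, y) \<in> ?W"
    then have ty: "t \<in> {0..1}" "y \<in> topspace X" "H (t, y) \<in> W" by auto
    obtain i r where i: "i \<in> J" "r \<in> unit_cube (d i)" "y = \<psi> i r" using cover[OF ty(2)] by auto
    have "continuous_map (top_of_set {0..1}) Z (\<lambda>t. H (t, y))"
      using continuous_map_top_of_set_compose[OF H[OF i(1)]
          continuous_on_Pair[OF continuous_on_id continuous_on_const], of r "{0..1}"] i by auto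
    from openin_continuous_map_preimage[OF this W]
    obtain e where e: "e > 0" "\<And>t'. t' \<in> {0..1} \<Longrightarrow> dist t' t \<le> e \<Longrightarrow> H (t', y) \<in> W"
    proof -
      assume that: "\<And>e. e > 0 \<Longrightarrow> (\<And>t'. t' \<in> {0..1} \<Longrightarrow> dist t' t \<le> e \<Longrightarrow> H (t', y) \<in> W) \<Longrightarrow> thesis"
      assume "openin (top_of_set {0..1}) {t \<in> topspace (top_of_set {0..1}). H (t, y) \<in> W}"
      with ty obtain e where "e > 0" "\<And>t'. t' \<in> {0..1} \<Longrightarrow> dist t' t < e \<Longrightarrow> H (t', y) \<in> W"
        unfolding openin_euclidean_subtopology_iff by auto
      then show thesis by (intro that[of "e/2"]) auto
    qed
    define N where "N = cball t e \<inter> {0..1}"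
    define A where "A = {p \<in> topspace X. \<exists>t'\<in>N. H (t', p) \<notin> W}"
    have "closedin X A"
    proof (rule weak_topology)
      fix j assume j: "j \<in> J"
      let ?C = "{z \<in> N \<times> unit_cube (d j). H (fst z, \<psi> j (snd z)) \<notin> W}"
      have "closedin (top_of_set (prism (d j))) {z \<in> topspace (top_of_set (prism (d j))). H (fst z, \<psi> j (snd z)) \<in> topspace Z - W}"
        by (rule closedin_continuous_map_preimage[OF H[OF j]]) (use W in blast)
      also have "{z \<in> topspace (top_of_set (prism (d j))). H (fst z, \<psi> j (snd z)) \<in> topspace Z - W} =
          {z \<in> prism (d j). H (fst z, \<psi> j (snd z)) \<notin> W}"
        using im char_in_topspace[OF j] by auto
      finally have "compact {z \<in> prism (d j). H (fst z, \<psi> j (snd z)) \<notin> W}"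
        by (rule closedin_compact[rotated]) (simp add: compact_Times compact_unit_cube)
      moreover have "closed (N \<times> (UNIV :: (nat \<Rightarrow> real) set))"
        by (simp add: N_def closed_Times closed_Int)
      moreover have "?C = {z \<in> prism (d j). H (fst z, \<psi> j (snd z)) \<notin> W} \<inter> (N \<times> UNIV)"
        by (auto simp: N_def)
      ultimately have C: "compact ?C" by (simp add: compact_Int_closed)
      have "compactin X ((\<lambda>z. \<psi> j (snd z)) ` ?C)"
      proof (rule image_compactin)
        show "compactin (top_of_set ?C) ?C" using C by (simp add: compactin_subtopology)
        show "continuous_map (top_of_set ?C) X (\<lambda>z. \<psi> j (snd z))"
          by (rule continuous_map_top_of_set_compose[OF continuous_char[OF j]]) (auto intro!: continuous_intros)
      qed
      moreover have "(\<lambda>z. \<psi> j (snd z)) ` ?C = A \<inter> \<psi> j ` unit_cube (d j)"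
        using char_in_topspace[OF j] by (force simp: A_def)
      ultimately show "closedin X (A \<inter> \<psi> j ` unit_cube (d j))"
        by (simp add: compactin_imp_closedin Hausdorff)
    qed (auto simp: A_def)
    moreover have "openin (top_of_set {0..1}) (ball t e \<inter> {0..1})"
      by (metis Int_commute open_ball openin_open_Int)
    moreover have "y \<in> topspace X - A" using e(2) ty(2) by (auto simp: A_def N_def dist_commute)
    moreover have "t \<in> ball t e \<inter> {0..1}" using e(1) ty(1) by simp
    moreover have "(ball t e \<inter> {0..1}) \<times> (topspace X - A) \<subseteq> ?W"
      by (auto simp: A_def N_def)
    ultimately show "\<exists>U V. openin (top_of_set {0..1}) U \<and> openin X V \<and> t \<in> U \<and> y \<in> V \<and> U \<times> V \<subseteq> ?W"
      by (meson openin_diff openin_topspace)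
  qed
  then show ?thesis using im by (auto simp: continuous_map_def)
qed

definition cell_of :: "'a \<Rightarrow> 'j" where
  "cell_of y = (THE j. j \<in> J \<and> y \<in> open_cell j)"

definition coords :: "'a \<Rightarrow> nat \<Rightarrow> real" where
  "coords y = inv_into (unit_cube (d (cell_of y)) - cube_boundary (d (cell_of y))) (\<psi> (cell_of y)) y"

lemma cell_of_eq:
  assumes "j \<in> J" "y \<in> open_cell j"
  shows "cell_of y = j"
  unfolding cell_of_def
proof (rule the_equality)
  fix i assume "i \<in> J \<and> y \<in> open_cell i"
  with assms disjoint_cells show "i = j" unfolding disjoint_family_on_def open_cell_def by blast
qed (use assms in simp)

lemma char_interior:
  assumes "j \<in> J" "s \<in> unit_cube (d j)" "s \<notin> cube_boundary (d j)"
  shows "cell_of (\<psi> j s) = j" "coords (\<psi> j s) = s"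
proof -
  show *: "cell_of (\<psi> j s) = j" by (rule cell_of_eq) (use assms in \<open>auto simp: open_cell_def\<close>)
  show "coords (\<psi> j s) = s" unfolding coords_def * by (rule inv_into_f_f[OF inj_char]) (use assms in auto)
qed

lemma char_boundary:
  assumes "j \<in> J" "s \<in> cube_boundary (d j)"
  shows "d (cell_of (\<psi> j s)) < d j"
proof -
  from closure_finite[OF assms(1)] obtain F where "F \<subseteq> J" "\<forall>i\<in>F. d i < d j"
    "\<psi> j ` cube_boundary (d j) \<subseteq> (\<Union>i\<in>F. open_cell i)"
    unfolding open_cell_def by (elim exE conjE)
  with assms(2) obtain i where "i \<in> J" "d i < d j" "\<psi> j s \<in> open_cell i" by blast
  then show ?thesis using cell_of_eq by metis
qed

text \<open>
  Closed cells are path connected, so a path component meets each of them in nothing or in the whole cell.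
  Hence unions of path components are closed, and a single component is also open.
\<close>

lemma connected_imp_path_connected:
  assumes "connected_space X"
  shows "path_connected_space X"
proof -
  have cell: "closed_cell j \<subseteq> Collect (path_component_of X p)" if "j \<in> J" "p \<in> closed_cell j" for j p
  proof (rule path_component_of_maximal[OF _ that(2)])
    show "path_connectedin X (closed_cell j)"
      unfolding closed_cell_def
      by (rule path_connectedin_continuous_map_image[OF continuous_char[OF that(1)]])
         (simp add: path_connectedin_subtopology path_connected_unit_cube)
  qed
  have clo: "closedin X S" if S: "S \<subseteq> topspace X"
    and *: "\<And>p q. p \<in> S \<Longrightarrow> path_component_of X p q \<Longrightarrow> q \<in> S" for S
  proof (rule weak_topology[OF S])
    fix j assume j: "j \<in> J"
    have "closed_cell j \<subseteq> S" if "S \<inter> closed_cell j \<noteq> {}"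
      using cell[OF j] * that by blast
    then have "S \<inter> closed_cell j = {} \<or> S \<inter> closed_cell j = closed_cell j" by blast
    then show "closedin X (S \<inter> \<psi> j ` unit_cube (d j))"
      using closed_cell_closed[OF j] unfolding closed_cell_def by auto
  qed
  have "path_component_of X p q" if pq: "p \<in> topspace X" "q \<in> topspace X" for p q
  proof -
    let ?P = "Collect (path_component_of X p)"
    have sub: "?P \<subseteq> topspace X" using path_component_in_topspace by fastforce
    have "closedin X ?P"
      by (rule clo[OF sub]) (meson mem_Collect_eq path_component_of_trans)
    moreover have "closedin X (topspace X - ?P)"
    proof (rule clo)
      fix a b assume "a \<in> topspace X - ?P" "path_component_of X a b"
      then show "b \<in> topspace X - ?P"
        by (metis Diff_iff mem_Collect_eq path_component_in_topspace path_component_of_sym path_component_of_trans)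
    qed auto
    then have "openin X ?P" using sub by (simp add: openin_closedin_eq)
    ultimately have "?P = {} \<or> ?P = topspace X" using assms unfolding connected_space_clopen_in by blast
    moreover have "p \<in> ?P" using pq by (simp add: path_component_of_refl)
    ultimately show ?thesis using pq by blast
  qed
  then show ?thesis by (simp add: path_connected_space_iff_path_component)
qed

text \<open>
  Lifting a map \<open>g\<close> through \<open>f\<close> up to homotopy over the cells of dimension less than \<open>k\<close>, by induction on
  \<open>k\<close>. The functions \<open>h\<close> and \<open>H\<close> are total, and only their composites with characteristic maps are
  required to be continuous; on cells that have not been reached their values are arbitrary. The vertex \<open>x\<close> is treated apart so that the homotopy is based.
\<close>

lemma skeleton_lifting:
  assumes Y: "path_connected_space Y" and f: "continuous_map Y Z f" and g: "continuous_map X Z g"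
    and y: "y \<in> topspace Y" "g x = f y"
    and x: "j0 \<in> J" "d j0 = 0" "x \<in> open_cell j0"
    and inj: "\<forall>m<n. cube_kernel_trivial m Y y Z (f y) f"
    and sur: "\<forall>m\<le>n. cube_surjective m Y y Z (f y) f"
    and k: "k \<le> Suc n"
  shows "\<exists>h H. h x = y \<and> (\<forall>t. H (t, x) = f y) \<and>
     (\<forall>j\<in>J. d j < k \<longrightarrow>
        continuous_map (top_of_set (unit_cube (d j))) Y (\<lambda>s. h (\<psi> j s)) \<and>
        continuous_map (top_of_set (prism (d j))) Z (\<lambda>z. H (fst z, \<psi> j (snd z))) \<and>
        (\<forall>s\<in>unit_cube (d j). H (0, \<psi> j s) = g (\<psi> j s) \<and> H (1, \<psi> j s) = f (h (\<psi> j s))))"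
  using k
proof (induction k)
  case 0
  show ?case by (rule exI[of _ "\<lambda>_. y"], rule exI[of _ "\<lambda>_. f y"]) simp
next
  case (Suc k)
  then obtain h H where h: "h x = y" and Hx: "\<And>t. H (t, x) = f y"
    and IH: "\<And>j. j \<in> J \<Longrightarrow> d j < k \<Longrightarrow> continuous_map (top_of_set (unit_cube (d j))) Y (\<lambda>s. h (\<psi> j s))"
      "\<And>j. j \<in> J \<Longrightarrow> d j < k \<Longrightarrow> continuous_map (top_of_set (prism (d j))) Z (\<lambda>z. H (fst z, \<psi> j (snd z)))"
      "\<And>j s. j \<in> J \<Longrightarrow> d j < k \<Longrightarrow> s \<in> unit_cube (d j) \<Longrightarrow> H (0, \<psi> j s) = g (\<psi> j s)"
      "\<And>j s. j \<in> J \<Longrightarrow> d j < k \<Longrightarrow> s \<in> unit_cube (d j) \<Longrightarrow> H (1, \<psi> j s) = f (h (\<psi> j s))"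
    by fastforce
  have cell_x: "cell_of x = j0" by (rule cell_of_eq[OF x(1,3)])
  \<comment> \<open>\<open>V\<close> extends the lift and \<open>G\<close> the homotopy over cell \<open>j\<close>; both are based if this is \<open>{x}\<close>.\<close>
  define good where "good = (\<lambda>j V G. continuous_map (top_of_set (unit_cube k)) Y V \<and>
      continuous_map (top_of_set (prism k)) Z G \<and>
      (\<forall>s\<in>unit_cube k. G (0, s) = g (\<psi> j s) \<and> G (1, s) = f (V s)) \<and>
      (\<forall>s\<in>cube_boundary k. V s = h (\<psi> j s)) \<and>
      (\<forall>t\<in>{0..1}. \<forall>s\<in>cube_boundary k. G (t, s) = H (t, \<psi> j s)) \<and>
      (\<forall>s\<in>unit_cube k - cube_boundary k. \<psi> j s = x \<longrightarrow> V s = y \<and> (\<forall>t. G (t, s) = f y)))"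
  have "\<exists>V G. good j V G" if j: "j \<in> J" "d j = k" for j
  proof (cases "j = j0")
    case True
    with j x have k0: "k = 0" by simp
    obtain s where "s \<in> unit_cube 0" "\<psi> j s = x"
      using x(3) unfolding open_cell_def x(2) True by auto
    then have "\<psi> j (\<lambda>_. 0) = x" by simp
    moreover have "f y \<in> topspace Z" using continuous_map_funspace[OF f] y by auto
    ultimately have "good j (\<lambda>_. y) (\<lambda>_. f y)"
      unfolding good_def k0 using y by simp
    then show ?thesis by blast
  next
    case False
    have nx: "\<psi> j s \<noteq> x" if "s \<in> unit_cube k - cube_boundary k" for s
      using that j False cell_x char_interior(1)[OF j(1), of s] by auto
    have bd: "\<exists>i\<in>J. d i < k \<and> (\<exists>r\<in>unit_cube (d i). \<psi> j s = \<psi> i r)" if "s \<in> cube_boundary k" for s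
    proof -
      from closure_finite[OF j(1)] obtain F where F: "F \<subseteq> J" "\<forall>i\<in>F. d i < d j"
        "\<psi> j ` cube_boundary (d j) \<subseteq> (\<Union>i\<in>F. \<psi> i ` (unit_cube (d i) - cube_boundary (d i)))"
        by (elim exE conjE)
      have "\<psi> j s \<in> \<psi> j ` cube_boundary (d j)" using that j(2) by simp
      then obtain i r where "i \<in> F" "r \<in> unit_cube (d i)" "\<psi> j s = \<psi> i r" using F(3) by blast
      then show ?thesis using F(1,2) j(2) by blast
    qed
    have Hc: "continuous_map (top_of_set ({0..1} \<times> cube_boundary k)) Z (\<lambda>z. H (fst z, \<psi> j (snd z)))"
      using homotopy_continuous_on_boundary[OF j(1), of Z H] IH(2) j(2) by simp
    have hc: "continuous_map (top_of_set (cube_boundary k)) Y (\<lambda>s. h (\<psi> j s))"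
    proof -
      have "continuous_map (top_of_set ({0..1::real} \<times> cube_boundary (d j))) Y (\<lambda>z. h (\<psi> j (snd z)))"
      proof (rule homotopy_continuous_on_boundary[OF j(1), of Y "\<lambda>z. h (snd z)", unfolded snd_conv])
        fix i assume "i \<in> J" "d i < d j"
        then have "continuous_map (top_of_set (unit_cube (d i))) Y (\<lambda>s. h (\<psi> i s))" using IH(1) j(2) by simp
        then show "continuous_map (top_of_set (prism (d i))) Y (\<lambda>z. h (\<psi> i (snd z)))"
          by (rule continuous_map_top_of_set_compose) (auto intro!: continuous_intros)
      qed
      from continuous_map_top_of_set_compose[OF this continuous_on_Pair[OF continuous_on_const continuous_on_id],
          of 0 "cube_boundary k"]
      show ?thesis using j(2) by simp
    qed
    have gc: "continuous_map (top_of_set (unit_cube k)) Z (\<lambda>s. g (\<psi> j s))"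
      using continuous_map_compose[OF continuous_char[OF j(1)] g] j(2) by (simp add: o_def)
    obtain V where V: "continuous_map (top_of_set (unit_cube k)) Y V"
      "\<And>s. s \<in> cube_boundary k \<Longrightarrow> V s = h (\<psi> j s)"
      "homotopic_along k Z (\<lambda>z. H (fst z, \<psi> j (snd z))) (\<lambda>s. g (\<psi> j s)) (\<lambda>s. f (V s))"
    proof (rule cube_lifting[OF _ _ f Y y(1) hc gc Hc])
      show "cube_kernel_trivial m Y y Z (f y) f" if "k = Suc m" for m using inj that Suc.prems by simp
      show "cube_surjective k Y y Z (f y) f" using sur Suc.prems by simp
      fix s assume "s \<in> cube_boundary k"
      from bd[OF this] obtain i r where i: "i \<in> J" "d i < k" "r \<in> unit_cube (d i)" "\<psi> j s = \<psi> i r" by blast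
      show "H (fst (0, s), \<psi> j (snd (0, s))) = g (\<psi> j s)" using IH(3)[OF i(1-3)] i(4) by simp
      show "H (fst (1, s), \<psi> j (snd (1, s))) = f (h (\<psi> j s))" using IH(4)[OF i(1-3)] i(4) by simp
    next
      fix V assume "continuous_map (top_of_set (unit_cube k)) Y V"
        "\<And>s. s \<in> cube_boundary k \<Longrightarrow> V s = h (\<psi> j s)"
        "homotopic_along k Z (\<lambda>z. H (fst z, \<psi> j (snd z))) (\<lambda>s. g (\<psi> j s)) (\<lambda>s. f (V s))"
      then show thesis by (rule that)
    qed
    from V(3) obtain G where "continuous_map (top_of_set (prism k)) Z G"
      "\<forall>s\<in>unit_cube k. G (0, s) = g (\<psi> j s)" "\<forall>s\<in>unit_cube k. G (1, s) = f (V s)"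
      "\<forall>t\<in>{0..1}. \<forall>s\<in>cube_boundary k. G (t, s) = H (fst (t, s), \<psi> j (snd (t, s)))"
      by (rule homotopic_alongE)
    then have "good j V G" unfolding good_def using V(1,2) nx by simp
    then show ?thesis by blast
  qed
  then have "\<forall>j. \<exists>V G. j \<in> J \<longrightarrow> d j = k \<longrightarrow> good j V G" by blast
  then obtain V where "\<forall>j. \<exists>G. j \<in> J \<longrightarrow> d j = k \<longrightarrow> good j (V j) G" by (rule choice[THEN exE])
  then obtain G where "\<forall>j. j \<in> J \<longrightarrow> d j = k \<longrightarrow> good j (V j) (G j)" by (rule choice[THEN exE])
  then have VG: "j \<in> J \<Longrightarrow> d j = k \<Longrightarrow> good j (V j) (G j)" for j by blast
  \<comment> \<open>Points of the new open cells are given by their coordinates; all others keep their values.\<close>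
  define h' where "h' = (\<lambda>p. if d (cell_of p) = k then V (cell_of p) (coords p) else h p)"
  define H' where "H' = (\<lambda>(t, p). if d (cell_of p) = k then G (cell_of p) (t, coords p) else H (t, p))"
  have low: "h' (\<psi> j s) = h (\<psi> j s)" "H' (t, \<psi> j s) = H (t, \<psi> j s)"
    if "j \<in> J" "d j < k" "s \<in> unit_cube (d j)" for j s t
  proof -
    have "d (cell_of (\<psi> j s)) \<noteq> k"
      using that char_interior(1)[of j s] char_boundary[of j s] by (cases "s \<in> cube_boundary (d j)") auto
    then show "h' (\<psi> j s) = h (\<psi> j s)" "H' (t, \<psi> j s) = H (t, \<psi> j s)" by (simp_all add: h'_def H'_def)
  qed
  have top: "h' (\<psi> j s) = V j s" "t \<in> {0..1} \<Longrightarrow> H' (t, \<psi> j s) = G j (t, s)"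
    if j: "j \<in> J" "d j = k" "s \<in> unit_cube k" for j s t
  proof -
    have "h' (\<psi> j s) = V j s \<and> (t \<in> {0..1} \<longrightarrow> H' (t, \<psi> j s) = G j (t, s))"
    proof (cases "s \<in> cube_boundary k")
      case True
      then have "d (cell_of (\<psi> j s)) \<noteq> k" using char_boundary[of j s] j by simp
      then show ?thesis using VG[OF j(1,2)] True by (simp add: h'_def H'_def good_def)
    next
      case False
      then show ?thesis using char_interior[of j s] j by (simp add: h'_def H'_def)
    qed
    then show "h' (\<psi> j s) = V j s" "t \<in> {0..1} \<Longrightarrow> H' (t, \<psi> j s) = G j (t, s)" by auto
  qed
  have hx: "h' x = y" "H' (t, x) = f y" for t
  proof -
    have "h' x = y \<and> H' (t, x) = f y"
    proof (cases "k = 0")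
      case True
      obtain s where s: "s \<in> unit_cube 0" "\<psi> j0 s = x" using x(3) unfolding open_cell_def x(2) by auto
      then have "coords x = s" using char_interior(2)[OF x(1), of s] x(2) by simp
      then show ?thesis using VG[OF x(1)] x(2) s True
        by (simp add: h'_def H'_def cell_x good_def)
    next
      case False
      then show ?thesis using h Hx x(2) by (simp add: h'_def H'_def cell_x)
    qed
    then show "h' x = y" "H' (t, x) = f y" by auto
  qed
  have "continuous_map (top_of_set (unit_cube (d j))) Y (\<lambda>s. h' (\<psi> j s)) \<and>
        continuous_map (top_of_set (prism (d j))) Z (\<lambda>z. H' (fst z, \<psi> j (snd z))) \<and>
        (\<forall>s\<in>unit_cube (d j). H' (0, \<psi> j s) = g (\<psi> j s) \<and> H' (1, \<psi> j s) = f (h' (\<psi> j s)))"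
    if j: "j \<in> J" "d j < Suc k" for j
  proof (cases "d j < k")
    case True
    have "continuous_map (top_of_set (unit_cube (d j))) Y (\<lambda>s. h' (\<psi> j s))"
      by (rule continuous_map_eq[OF IH(1)[OF j(1) True]]) (simp add: low(1)[OF j(1) True])
    moreover have "continuous_map (top_of_set (prism (d j))) Z (\<lambda>z. H' (fst z, \<psi> j (snd z)))"
      by (rule continuous_map_eq[OF IH(2)[OF j(1) True]]) (auto simp: low(2)[OF j(1) True])
    ultimately show ?thesis using IH(3,4)[OF j(1) True] low[OF j(1) True] by simp
  next
    case False
    with j have k: "d j = k" by simp
    note VG = VG[OF j(1) k, unfolded good_def] and top = top[OF j(1) k]
    have "continuous_map (top_of_set (unit_cube k)) Y (\<lambda>s. h' (\<psi> j s))"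
      by (rule continuous_map_eq[OF conjunct1[OF VG]]) (simp add: top(1))
    moreover have "continuous_map (top_of_set (prism k)) Z (\<lambda>z. H' (fst z, \<psi> j (snd z)))"
      by (rule continuous_map_eq[OF conjunct1[OF conjunct2[OF VG]]]) (auto simp: top(2))
    ultimately show ?thesis unfolding k using VG top by simp
  qed
  then show ?case using hx by (intro exI[of _ h'] exI[of _ H']) blast
qed

text \<open>
  Over the complex itself the pieces are continuous by the weak topology. In homotopy classes, composition
  with \<open>f\<close> maps onto the based classes of maps from a complex of dimension at most \<open>n\<close>.
\<close>

lemma complex_lifting:
  assumes Y: "path_connected_space Y" and f: "continuous_map Y Z f" and g: "continuous_map X Z g"
    and y: "y \<in> topspace Y" "g x = f y"
    and x: "j0 \<in> J" "d j0 = 0" "x \<in> open_cell j0"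
    and dim: "\<And>j. j \<in> J \<Longrightarrow> d j \<le> n"
    and inj: "\<forall>m<n. cube_kernel_trivial m Y y Z (f y) f"
    and sur: "\<forall>m\<le>n. cube_surjective m Y y Z (f y) f"
  obtains h where "continuous_map X Y h" "h x = y"
    "homotopic_with (\<lambda>k. k x = f y) X Z g (\<lambda>p. f (h p))"
proof -
  from skeleton_lifting[OF Y f g y x inj sur order_refl]
  obtain h H where h: "h x = y" and Hx: "\<forall>t. H (t, x) = f y"
    and cells: "\<forall>j\<in>J. d j < Suc n \<longrightarrow>
        continuous_map (top_of_set (unit_cube (d j))) Y (\<lambda>s. h (\<psi> j s)) \<and>
        continuous_map (top_of_set (prism (d j))) Z (\<lambda>z. H (fst z, \<psi> j (snd z))) \<and>
        (\<forall>s\<in>unit_cube (d j). H (0, \<psi> j s) = g (\<psi> j s) \<and> H (1, \<psi> j s) = f (h (\<psi> j s)))"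
    by (elim exE conjE)
  have hc: "continuous_map (top_of_set (unit_cube (d j))) Y (\<lambda>s. h (\<psi> j s))"
    and Hc: "continuous_map (top_of_set (prism (d j))) Z (\<lambda>z. H (fst z, \<psi> j (snd z)))"
    and ends: "\<forall>s\<in>unit_cube (d j). H (0, \<psi> j s) = g (\<psi> j s) \<and> H (1, \<psi> j s) = f (h (\<psi> j s))"
    if "j \<in> J" for j
    using cells that dim[OF that] by (simp_all add: less_Suc_eq_le)
  have cover: "\<exists>j\<in>J. \<exists>s\<in>unit_cube (d j). p = \<psi> j s" if "p \<in> topspace X" for p
    using that unfolding cells_cover[symmetric] by blast
  have HH: "continuous_map (prod_topology (top_of_set {0..1}) X) Z H"
    by (rule homotopy_continuous[OF Hc])
  have "continuous_map (prod_topology (top_of_set {0..1::real}) X) Y (\<lambda>z. h (snd z))"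
  proof (rule homotopy_continuous)
    show "continuous_map (top_of_set (prism (d j))) Y (\<lambda>z. h (snd (fst z, \<psi> j (snd z))))" if "j \<in> J" for j
      unfolding snd_conv
      by (rule continuous_map_top_of_set_compose[OF hc[OF that]]) (auto intro!: continuous_intros)
  qed
  moreover have "continuous_map X (prod_topology (top_of_set {0..1::real}) X) (\<lambda>p. (0, p))"
    by (intro continuous_map_pairedI) auto
  ultimately have "continuous_map X Y ((\<lambda>z. h (snd z)) \<circ> (\<lambda>p. (0::real, p)))"
    by (rule continuous_map_compose[rotated])
  then have "continuous_map X Y h" by (simp add: o_def)
  moreover have "x \<in> topspace X" using x unfolding cells_cover[symmetric] open_cell_def by blast
  then have "homotopic_with (\<lambda>k. k x = f y) X Z g (\<lambda>p. f (h p))"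
  proof (subst homotopic_with)
    have "H (0, p) = g p \<and> H (1, p) = f (h p)" if "p \<in> topspace X" for p
      using cover[OF that] ends by blast
    then show "\<exists>H. continuous_map (prod_topology (top_of_set {0..1::real}) X) Z H \<and> (\<forall>p\<in>topspace X. H (0, p) = g p) \<and>
        (\<forall>p\<in>topspace X. H (1, p) = f (h p)) \<and> (\<forall>t\<in>{0..1}. H (t, x) = f y)"
      using HH Hx by blast
  qed simp
  ultimately show ?thesis using that h by blast
qed

end


section \<open>Maps induced on homotopy groups\<close>

lemma pair_homotopic_refl: "f \<in> pair_maps A B X x \<Longrightarrow> (f, f) \<in> pair_homotopic A B X x"
  using equiv_pair_homotopic[of A B X x] unfolding equiv_def refl_on_def by blast

lemma pair_homotopic_sym: "(f, g) \<in> pair_homotopic A B X x \<Longrightarrow> (g, f) \<in> pair_homotopic A B X x"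
  using equiv_pair_homotopic[of A B X x] unfolding equiv_def by (blast dest: symD)

lemma pair_homotopic_trans:
  "(f, g) \<in> pair_homotopic A B X x \<Longrightarrow> (g, h) \<in> pair_homotopic A B X x \<Longrightarrow> (f, h) \<in> pair_homotopic A B X x"
  using equiv_pair_homotopic[of A B X x] unfolding equiv_def by (blast dest: transD)

lemma pair_homotopic_imp_pair_maps:
  assumes "(f, g) \<in> pair_homotopic A B X x"
  shows "f \<in> pair_maps A B X x" "g \<in> pair_maps A B X x"
  using equiv_pair_homotopic[of A B X x] assms unfolding equiv_def by auto

lemma pair_class_eq_iff:
  assumes "f \<in> pair_maps A B X x" "g \<in> pair_maps A B X x"
  shows "pair_class A B X x f = pair_class A B X x g \<longleftrightarrow> (f, g) \<in> pair_homotopic A B X x"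
  using eq_equiv_class_iff[OF equiv_pair_homotopic assms] .

lemma pair_classesE:
  assumes "c \<in> pair_classes A B X x"
  obtains u where "u \<in> pair_maps A B X x" "c = pair_class A B X x u"
  using assms unfolding pair_classes_def by (rule quotientE)

lemma pair_class_in_pair_classes: "u \<in> pair_maps A B X x \<Longrightarrow> pair_class A B X x u \<in> pair_classes A B X x"
  unfolding pair_classes_def by (rule quotientI)

lemma pair_maps_compose:
  assumes "u \<in> pair_maps A B X x" "f \<in> pair_maps X {x} Y y"
  shows "f \<circ> u \<in> pair_maps A B Y y"
  using assms unfolding pair_maps_def by (auto intro: continuous_map_compose)

lemma pair_homotopic_compose_left:
  assumes "(u, v) \<in> pair_homotopic A B X x" "f \<in> pair_maps X {x} Y y"
  shows "(f \<circ> u, f \<circ> v) \<in> pair_homotopic A B Y y"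
  using assms unfolding pair_homotopic_def pair_maps_def
  by (auto intro: homotopic_with_compose_continuous_map_left)

lemma pair_homotopic_compose_right:
  assumes "(f, g) \<in> pair_homotopic X {x} Y y" "u \<in> pair_maps A B X x"
  shows "(f \<circ> u, g \<circ> u) \<in> pair_homotopic A B Y y"
  using assms unfolding pair_homotopic_def pair_maps_def
  by (auto intro: homotopic_with_compose_continuous_map_right)

lemma UN_pair_class:
  assumes "u \<in> pair_maps A B X x"
    and "\<And>v. (u, v) \<in> pair_homotopic A B X x \<Longrightarrow> F v = F u"
  shows "(\<Union>v\<in>pair_class A B X x u. F v) = F u"
proof -
  have "u \<in> pair_class A B X x u" using pair_homotopic_refl[OF assms(1)] by simp
  moreover have "(\<Union>v\<in>pair_class A B X x u. F v) = (\<Union>v\<in>pair_class A B X x u. F u)"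
    by (rule SUP_cong[OF refl], rule assms(2)) simp
  ultimately show ?thesis by auto
qed

lemma homotopy_group_map_class:
  assumes f: "f \<in> pair_maps X {x} Y y" and u: "u \<in> pair_maps (cube i) (cube_boundary i) X x"
  shows "homotopy_group_map i Y y f (pair_class (cube i) (cube_boundary i) X x u) =
         pair_class (cube i) (cube_boundary i) Y y (f \<circ> u)"
  unfolding homotopy_group_map_def
proof (rule UN_pair_class[OF u])
  fix v assume "(u, v) \<in> pair_homotopic (cube i) (cube_boundary i) X x"
  from pair_homotopic_sym[OF pair_homotopic_compose_left[OF this f]]
  show "pair_class (cube i) (cube_boundary i) Y y (f \<circ> v) = pair_class (cube i) (cube_boundary i) Y y (f \<circ> u)"
    by (subst pair_class_eq_iff) (auto dest: pair_homotopic_imp_pair_maps)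
qed

lemma homotopy_group_map_in_pair_classes:
  assumes "f \<in> pair_maps X {x} Y y" "c \<in> pair_classes (cube i) (cube_boundary i) X x"
  shows "homotopy_group_map i Y y f c \<in> pair_classes (cube i) (cube_boundary i) Y y"
  using pair_classesE[OF assms(2)] homotopy_group_map_class[OF assms(1)]
    pair_class_in_pair_classes[OF pair_maps_compose[OF _ assms(1)]] by metis

lemma homotopy_group_map_compose_id:
  assumes f: "f \<in> pair_maps Y {y} X x" and g: "g \<in> pair_maps X {x} Y y"
    and fg: "(f \<circ> g, id) \<in> pair_homotopic X {x} X x"
    and c: "c \<in> pair_classes (cube i) (cube_boundary i) X x"
  shows "homotopy_group_map i X x f (homotopy_group_map i Y y g c) = c"
proof -
  obtain u where u: "u \<in> pair_maps (cube i) (cube_boundary i) X x"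
    "c = pair_class (cube i) (cube_boundary i) X x u" using pair_classesE[OF c] .
  have "(f \<circ> (g \<circ> u), u) \<in> pair_homotopic (cube i) (cube_boundary i) X x"
    using pair_homotopic_compose_right[OF fg u(1)] by (simp add: comp_assoc)
  then have "pair_class (cube i) (cube_boundary i) X x (f \<circ> (g \<circ> u)) = c"
    unfolding u(2) by (subst pair_class_eq_iff) (auto dest: pair_homotopic_imp_pair_maps)
  then show ?thesis
    unfolding u(2) by (simp add: homotopy_group_map_class g f u(1) pair_maps_compose[OF u(1) g])
qed

text \<open>
  The common content of \<open>induces_iso\<close> in dimension 0, where it concerns sets of path components, and in
  the positive dimensions.
\<close>

definition pi_bijective :: "nat \<Rightarrow> 'a topology \<Rightarrow> 'a \<Rightarrow> 'b topology \<Rightarrow> 'b \<Rightarrow> ('a \<Rightarrow> 'b) \<Rightarrow> bool" where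
  "pi_bijective i X x Y y f \<longleftrightarrow>
     bij_betw (homotopy_group_map i Y y f)
       (pair_classes (cube i) (cube_boundary i) X x) (pair_classes (cube i) (cube_boundary i) Y y)"

lemma carrier_homotopy_group: "carrier (homotopy_group i X x) = pair_classes (cube i) (cube_boundary i) X x"
  by (simp add: homotopy_group_def)

lemma induces_iso_imp_pi_bijective: "induces_iso i X x Y y f \<Longrightarrow> pi_bijective i X x Y y f"
  by (auto simp: induces_iso_def pi_bijective_def carrier_homotopy_group iso_def split: if_splits)

text \<open>
  On homotopy groups \<open>f \<circ> g\<close> induces the identity, so \<open>g\<close> induces the inverse of the bijection
  induced by \<open>f\<close>.
\<close>

lemma pi_bijective_right_inverse:
  assumes f: "f \<in> pair_maps Y {y} X x" and g: "g \<in> pair_maps X {x} Y y"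
    and fg: "(f \<circ> g, id) \<in> pair_homotopic X {x} X x" and bij: "pi_bijective i Y y X x f"
  shows "pi_bijective i X x Y y g"
  unfolding pi_bijective_def
proof (rule bij_betw_byWitness[where f' = "homotopy_group_map i X x f"])
  let ?X = "pair_classes (cube i) (cube_boundary i) X x" and ?Y = "pair_classes (cube i) (cube_boundary i) Y y"
  show inv: "\<forall>c\<in>?X. homotopy_group_map i X x f (homotopy_group_map i Y y g c) = c"
    using homotopy_group_map_compose_id[OF f g fg] by blast
  show "\<forall>c\<in>?Y. homotopy_group_map i Y y g (homotopy_group_map i X x f c) = c"
  proof
    fix c assume c: "c \<in> ?Y"
    note fc = homotopy_group_map_in_pair_classes[OF f c]
    have "inj_on (homotopy_group_map i X x f) ?Y" using bij by (simp add: pi_bijective_def bij_betw_def)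
    then show "homotopy_group_map i Y y g (homotopy_group_map i X x f c) = c"
      by (rule inj_onD) (use inv fc c homotopy_group_map_in_pair_classes[OF g fc] in auto)
  qed
qed (use homotopy_group_map_in_pair_classes[OF f] homotopy_group_map_in_pair_classes[OF g] in auto)

lemma pair_maps_cube_iff:
  "u \<in> pair_maps (cube i) (cube_boundary i) Y y \<longleftrightarrow>
     continuous_map (top_of_set (unit_cube i)) Y u \<and> (\<forall>s\<in>cube_boundary i. u s = y)"
  by (simp add: pair_maps_def cube_eq)

lemma pair_homotopic_cube_iff:
  "(u, v) \<in> pair_homotopic (cube i) (cube_boundary i) Y y \<longleftrightarrow> homotopic_along i Y (\<lambda>_. y) u v"
proof -
  have "homotopic_with (\<lambda>h. \<forall>b\<in>cube_boundary i. h b = y) (cube i) Y u v \<longleftrightarrow>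
    (\<exists>h. continuous_map (prod_topology (top_of_set {0..1::real}) (cube i)) Y h \<and>
              (\<forall>x \<in> topspace (cube i). h(0,x) = u x) \<and>
              (\<forall>x \<in> topspace (cube i). h(1,x) = v x) \<and>
              (\<forall>t \<in> {0..1}. \<forall>b\<in>cube_boundary i. h(t, b) = y))"
  proof (rule homotopic_with)
    fix h k :: "(nat \<Rightarrow> real) \<Rightarrow> 'a"
    assume "\<And>s. s \<in> topspace (cube i) \<Longrightarrow> h s = k s"
    then have "\<And>s. s \<in> cube_boundary i \<Longrightarrow> h s = k s" using cube_boundary_subset[of i] by auto
    then show "(\<forall>b\<in>cube_boundary i. h b = y) = (\<forall>b\<in>cube_boundary i. k b = y)" by simp
  qed
  then show ?thesis
    unfolding pair_homotopic_def homotopic_along_def by (auto simp: cube_eq)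
qed

lemma pi_bijective_imp_cube_kernel_trivial:
  assumes f: "f \<in> pair_maps X {x} Y y" and bij: "pi_bijective i X x Y y f" and x: "x \<in> topspace X"
  shows "cube_kernel_trivial i X x Y y f"
  unfolding cube_kernel_trivial_def
proof (intro allI impI)
  fix a assume "continuous_map (top_of_set (unit_cube i)) X a" "\<forall>s\<in>cube_boundary i. a s = x"
    and fa: "homotopic_along i Y (\<lambda>_. y) (\<lambda>s. f (a s)) (\<lambda>_. y)"
  let ?cl = "pair_class (cube i) (cube_boundary i)" and ?f = "homotopy_group_map i Y y f"
  have a: "a \<in> pair_maps (cube i) (cube_boundary i) X x" unfolding pair_maps_cube_iff by (intro conjI) fact+
  have c: "(\<lambda>_. x) \<in> pair_maps (cube i) (cube_boundary i) X x" using x by (simp add: pair_maps_cube_iff)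
  have "(f \<circ> a, f \<circ> (\<lambda>_. x)) \<in> pair_homotopic (cube i) (cube_boundary i) Y y"
    using fa f by (simp add: pair_homotopic_cube_iff o_def pair_maps_def)
  then have "?f (?cl X x a) = ?f (?cl X x (\<lambda>_. x))"
    unfolding homotopy_group_map_class[OF f a] homotopy_group_map_class[OF f c]
    by (subst pair_class_eq_iff) (auto dest: pair_homotopic_imp_pair_maps)
  then have "?cl X x a = ?cl X x (\<lambda>_. x)"
    by (rule inj_onD[OF bij_betw_imp_inj_on[OF bij[unfolded pi_bijective_def]]])
       (intro pair_class_in_pair_classes a c)+
  then show "homotopic_along i X (\<lambda>_. x) a (\<lambda>_. x)"
    by (simp add: pair_class_eq_iff[OF a c] pair_homotopic_cube_iff)
qed

lemma pi_bijective_imp_cube_surjective: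
  assumes f: "f \<in> pair_maps X {x} Y y" and bij: "pi_bijective i X x Y y f"
  shows "cube_surjective i X x Y y f"
  unfolding cube_surjective_def
proof (intro allI impI)
  fix w assume "continuous_map (top_of_set (unit_cube i)) Y w" "\<forall>s\<in>cube_boundary i. w s = y"
  let ?cl = "pair_class (cube i) (cube_boundary i)"
  have w: "w \<in> pair_maps (cube i) (cube_boundary i) Y y" unfolding pair_maps_cube_iff by (intro conjI) fact+
  have "?cl Y y w \<in> homotopy_group_map i Y y f ` pair_classes (cube i) (cube_boundary i) X x"
    unfolding bij_betw_imp_surj_on[OF bij[unfolded pi_bijective_def]]
    by (rule pair_class_in_pair_classes[OF w])
  then obtain c where c: "c \<in> pair_classes (cube i) (cube_boundary i) X x" "?cl Y y w = homotopy_group_map i Y y f c" ..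
  obtain v where v: "v \<in> pair_maps (cube i) (cube_boundary i) X x" "c = ?cl X x v"
    using pair_classesE[OF c(1)] .
  have "?cl Y y (f \<circ> v) = ?cl Y y w" using c(2) unfolding v(2) homotopy_group_map_class[OF f v(1)] by simp
  then have "(f \<circ> v, w) \<in> pair_homotopic (cube i) (cube_boundary i) Y y"
    by (simp add: pair_class_eq_iff[OF pair_maps_compose[OF v(1) f] w])
  then show "\<exists>v. continuous_map (top_of_set (unit_cube i)) X v \<and> (\<forall>s\<in>cube_boundary i. v s = x) \<and>
               homotopic_along i Y (\<lambda>_. y) (\<lambda>s. f (v s)) w"
    using v(1) by (auto simp: pair_homotopic_cube_iff pair_maps_cube_iff o_def)
qed

section \<open>Homotopy equivalences induce isomorphisms\<close>

text \<open>
  Concatenation is well defined on classes in positive dimension: for \<open>i \<noteq> 0\<close> the common face of the two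
  halves is in the boundary of both, where all homotopies are constant.
\<close>

lemma homotopic_along_cube_concat:
  assumes i: "i \<noteq> 0" and u: "homotopic_along i Y (\<lambda>_. y) u u'" and v: "homotopic_along i Y (\<lambda>_. y) v v'"
  shows "homotopic_along i Y (\<lambda>_. y) (cube_concat u v) (cube_concat u' v')"
proof -
  obtain G where G: "continuous_map (top_of_set (prism i)) Y G"
    "\<forall>s\<in>unit_cube i. G (0, s) = u s" "\<forall>s\<in>unit_cube i. G (1, s) = u' s"
    "\<forall>t\<in>{0..1}. \<forall>s\<in>cube_boundary i. G (t, s) = y"
    by (rule homotopic_alongE[OF u])
  obtain K where K: "continuous_map (top_of_set (prism i)) Y K"
    "\<forall>s\<in>unit_cube i. K (0, s) = v s" "\<forall>s\<in>unit_cube i. K (1, s) = v' s"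
    "\<forall>t\<in>{0..1}. \<forall>s\<in>cube_boundary i. K (t, s) = y"
    by (rule homotopic_alongE[OF v])
  have left: "s(0 := 2 * s 0) \<in> unit_cube i" if "s \<in> unit_cube i" "s 0 \<le> 1/2" for s
    using that i by (auto simp: unit_cube_def)
  have right: "s(0 := 2 * s 0 - 1) \<in> unit_cube i" if "s \<in> unit_cube i" "1/2 \<le> s 0" for s
    using that i by (auto simp: unit_cube_def)
  have left_bd: "s(0 := 2 * s 0) \<in> cube_boundary i" if s: "s \<in> cube_boundary i" "s 0 \<le> 1/2" for s
  proof -
    obtain j where j: "j < i" "s j = 0 \<or> s j = 1" and "s \<in> unit_cube i" using s by (auto simp: cube_boundary_def)
    moreover have "(s(0 := 2 * s 0)) j = 0 \<or> (s(0 := 2 * s 0)) j = 1" using j(2) s(2) by (cases "j = 0") auto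
    ultimately show ?thesis using left s(2) unfolding cube_boundary_def topspace_cube by blast
  qed
  have right_bd: "s(0 := 2 * s 0 - 1) \<in> cube_boundary i" if s: "s \<in> cube_boundary i" "1/2 \<le> s 0" for s
  proof -
    obtain j where j: "j < i" "s j = 0 \<or> s j = 1" and "s \<in> unit_cube i" using s by (auto simp: cube_boundary_def)
    moreover have "(s(0 := 2 * s 0 - 1)) j = 0 \<or> (s(0 := 2 * s 0 - 1)) j = 1" using j(2) s(2) by (cases "j = 0") auto
    ultimately show ?thesis using right s(2) unfolding cube_boundary_def topspace_cube by blast
  qed
  define M where "M = (\<lambda>z. if snd z 0 \<le> 1/2 then G (fst z, (snd z)(0 := 2 * snd z 0))
                           else K (fst z, (snd z)(0 := 2 * snd z 0 - 1)))"
  have "continuous_map (top_of_set (prism i)) Y M"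
    unfolding M_def
  proof (rule continuous_map_top_of_set_cases_le)
    show "continuous_map (top_of_set {z \<in> prism i. snd z 0 \<le> 1/2}) Y (\<lambda>z. G (fst z, (snd z)(0 := 2 * snd z 0)))"
      by (rule continuous_map_top_of_set_compose[OF G(1)]) (auto intro!: continuous_intros left)
    show "continuous_map (top_of_set {z \<in> prism i. 1/2 \<le> snd z 0}) Y (\<lambda>z. K (fst z, (snd z)(0 := 2 * snd z 0 - 1)))"
      by (rule continuous_map_top_of_set_compose[OF K(1)]) (auto intro!: continuous_intros right)
    fix z assume z: "z \<in> prism i" "snd z 0 = 1/2"
    \<comment> \<open>On the middle slice both branches take the value \<open>y\<close>.\<close>
    have "(snd z)(0 := 1) \<in> cube_boundary i" "(snd z)(0 := 0) \<in> cube_boundary i"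
      using z(1) i by (auto simp: cube_boundary_def unit_cube_def intro!: exI[of _ 0])
    moreover have twice: "2 * snd z 0 = 1" using z(2) by simp
    ultimately show "G (fst z, (snd z)(0 := 2 * snd z 0)) = K (fst z, (snd z)(0 := 2 * snd z 0 - 1))"
      using G(4) K(4) z(1) twice by (auto simp: mem_Times_iff)
  qed (intro continuous_intros)+
  moreover have "M (0, s) = cube_concat u v s \<and> M (1, s) = cube_concat u' v' s" if "s \<in> unit_cube i" for s
    using that left[of s] right[of s] G(2,3) K(2,3) by (simp add: M_def cube_concat_def)
  moreover have "M (t, s) = y" if "t \<in> {0..1}" "s \<in> cube_boundary i" for t s
    using that left_bd[of s] right_bd[of s] G(4) K(4) by (simp add: M_def)
  ultimately show ?thesis unfolding homotopic_along_def by (intro exI[of _ M]) simp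
qed

lemma homotopy_group_mult_class:
  assumes i: "i \<noteq> 0" and u: "u \<in> pair_maps (cube i) (cube_boundary i) X x"
    and v: "v \<in> pair_maps (cube i) (cube_boundary i) X x"
  shows "mult (homotopy_group i X x) (pair_class (cube i) (cube_boundary i) X x u)
             (pair_class (cube i) (cube_boundary i) X x v) =
         pair_class (cube i) (cube_boundary i) X x (cube_concat u v)"
proof -
  let ?R = "pair_homotopic (cube i) (cube_boundary i) X x" and ?cl = "pair_class (cube i) (cube_boundary i) X x"
  have eq: "?cl (cube_concat u' v') = ?cl (cube_concat u'' v'')" if "(u'', u') \<in> ?R" "(v'', v') \<in> ?R" for u' u'' v' v''
  proof -
    have "(cube_concat u' v', cube_concat u'' v'') \<in> ?R"
      using that[THEN pair_homotopic_sym] unfolding pair_homotopic_cube_iff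
      by (rule homotopic_along_cube_concat[OF i])
    then show ?thesis by (subst pair_class_eq_iff) (auto dest: pair_homotopic_imp_pair_maps)
  qed
  have "(\<Union>u'\<in>?cl u. \<Union>v'\<in>?cl v. ?cl (cube_concat u' v')) = (\<Union>u'\<in>?cl u. ?cl (cube_concat u' v))"
  proof (rule SUP_cong[OF refl])
    fix u' assume "u' \<in> ?cl u"
    then have "(u, u') \<in> ?R" by simp
    then have "(u', u') \<in> ?R" by (intro pair_homotopic_refl pair_homotopic_imp_pair_maps(2))
    then show "(\<Union>v'\<in>?cl v. ?cl (cube_concat u' v')) = ?cl (cube_concat u' v)"
      by (rule UN_pair_class[OF v eq])
  qed
  also have "\<dots> = ?cl (cube_concat u v)"
    by (rule UN_pair_class[OF u eq[OF _ pair_homotopic_refl[OF v]]])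
  finally show ?thesis by (simp add: homotopy_group_def)
qed

lemma cube_concat_in_pair_maps:
  assumes "i \<noteq> 0" "u \<in> pair_maps (cube i) (cube_boundary i) X x" "v \<in> pair_maps (cube i) (cube_boundary i) X x"
  shows "cube_concat u v \<in> pair_maps (cube i) (cube_boundary i) X x"
  using homotopic_along_cube_concat[OF assms(1)] assms(2,3)[THEN pair_homotopic_refl]
  by (metis pair_homotopic_cube_iff pair_homotopic_imp_pair_maps(1))

lemma homotopy_group_map_hom:
  assumes i: "i \<noteq> 0" and f: "f \<in> pair_maps X {x} Y y"
  shows "homotopy_group_map i Y y f \<in> hom (homotopy_group i X x) (homotopy_group i Y y)"
proof (rule homI; unfold carrier_homotopy_group)
  fix c d assume c: "c \<in> pair_classes (cube i) (cube_boundary i) X x"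
    and d: "d \<in> pair_classes (cube i) (cube_boundary i) X x"
  obtain u where u: "u \<in> pair_maps (cube i) (cube_boundary i) X x" "c = pair_class (cube i) (cube_boundary i) X x u"
    using pair_classesE[OF c] .
  obtain v where v: "v \<in> pair_maps (cube i) (cube_boundary i) X x" "d = pair_class (cube i) (cube_boundary i) X x v"
    using pair_classesE[OF d] .
  have "f \<circ> cube_concat u v = cube_concat (f \<circ> u) (f \<circ> v)"
    by (auto simp: cube_concat_def)
  then show "homotopy_group_map i Y y f (c \<otimes>\<^bsub>homotopy_group i X x\<^esub> d) =
      homotopy_group_map i Y y f c \<otimes>\<^bsub>homotopy_group i Y y\<^esub> homotopy_group_map i Y y f d"
    unfolding u(2) v(2)
    by (simp add: homotopy_group_mult_class i u(1) v(1) homotopy_group_map_class[OF f]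
        cube_concat_in_pair_maps pair_maps_compose[OF _ f])
qed (rule homotopy_group_map_in_pair_classes[OF f])

lemma based_homotopy_equivalence_induces_iso:
  assumes "based_homotopy_equivalence X x f"
  shows "induces_iso i X x X x f"
proof -
  obtain g where fg: "f \<in> pair_maps X {x} X x" "g \<in> pair_maps X {x} X x"
    "(g \<circ> f, id) \<in> pair_homotopic X {x} X x" "(f \<circ> g, id) \<in> pair_homotopic X {x} X x"
    using assms unfolding based_homotopy_equivalence_def self_maps_def by blast
  have "bij_betw (homotopy_group_map i X x f) (pair_classes (cube i) (cube_boundary i) X x)
      (pair_classes (cube i) (cube_boundary i) X x)"
    by (rule bij_betw_byWitness[where f' = "homotopy_group_map i X x g"])
       (auto simp: homotopy_group_map_compose_id[OF fg(2,1,3)] homotopy_group_map_compose_id[OF fg(1,2,4)]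
          homotopy_group_map_in_pair_classes[OF fg(1)] homotopy_group_map_in_pair_classes[OF fg(2)])
  then show ?thesis
    using homotopy_group_map_hom[OF _ fg(1), of i]
    by (cases "i = 0") (auto simp: induces_iso_def carrier_homotopy_group iso_def)
qed

section \<open>The self-closeness number of a finite-dimensional complex\<close>

text \<open>
  Lift the identity of \<open>X\<close> through \<open>f\<close>.
\<close>

lemma homotopy_right_inverse:
  assumes X: "based_CW_complex X x J d \<Phi>" "has_CW_dimension J d n" "connected_space X"
    and f: "f \<in> self_maps X x" and bij: "\<And>i. i \<le> n \<Longrightarrow> pi_bijective i X x X x f"
  obtains g where "g \<in> self_maps X x" "(f \<circ> g, id) \<in> pair_homotopic X {x} X x"
proof -
  obtain \<psi> where \<psi>: "cubical_complex X J d \<psi>"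
    "\<And>j. j \<in> J \<Longrightarrow> \<psi> j ` (unit_cube (d j) - cube_boundary (d j)) = \<Phi> j ` disc_interior (d j)"
    using CW_complex_imp_cubical_complex X(1) unfolding based_CW_complex_def by metis
  interpret cubical_complex X J d \<psi> by (rule \<psi>(1))
  obtain j0 where j0: "j0 \<in> J" "d j0 = 0" "x \<in> open_cell j0"
    using X(1) \<psi>(2) unfolding based_CW_complex_def open_cell_def by metis
  then have x: "x \<in> topspace X" unfolding cells_cover[symmetric] open_cell_def by blast
  have fx: "continuous_map X X f" "f x = x" and f': "f \<in> pair_maps X {x} X x"
    using f by (auto simp: self_maps_def pair_maps_def)
  obtain g where g: "continuous_map X X g" "g x = x" "homotopic_with (\<lambda>k. k x = f x) X X id (\<lambda>p. f (g p))"
  proof (rule complex_lifting[OF connected_imp_path_connected[OF X(3)] fx(1) continuous_map_id x _ j0])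
    show "id x = f x" using fx(2) by simp
    show "d j \<le> n" if "j \<in> J" for j using X(2) that by (simp add: has_CW_dimension_def)
    show "\<forall>m<n. cube_kernel_trivial m X x X (f x) f"
      using pi_bijective_imp_cube_kernel_trivial[OF f' bij x] fx(2) by simp
    show "\<forall>m\<le>n. cube_surjective m X x X (f x) f"
      using pi_bijective_imp_cube_surjective[OF f' bij] fx(2) by simp
  qed
  have "(id, f \<circ> g) \<in> pair_homotopic X {x} X x"
    using g(3) fx(2) by (simp add: pair_homotopic_def o_def)
  from pair_homotopic_sym[OF this] show ?thesis
    by (rule that[rotated]) (simp add: self_maps_def pair_maps_def g(1,2))
qed

text \<open>
  A right inverse \<open>g\<close> of \<open>f\<close> satisfies the same hypothesis, so it has a right inverse \<open>h\<close> in turn. Then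
  \<open>f \<simeq> f \<circ> g \<circ> h \<simeq> h\<close>, and \<open>g\<close> is a two-sided inverse of \<open>f\<close>.
\<close>

lemma pi_bijective_imp_based_homotopy_equivalence:
  assumes X: "based_CW_complex X x J d \<Phi>" "has_CW_dimension J d n" "connected_space X"
    and f: "f \<in> self_maps X x" and bij: "\<And>i. i \<le> n \<Longrightarrow> pi_bijective i X x X x f"
  shows "based_homotopy_equivalence X x f"
proof -
  obtain g where g: "g \<in> self_maps X x" and fg: "(f \<circ> g, id) \<in> pair_homotopic X {x} X x"
    by (rule homotopy_right_inverse[OF X f bij])
  note maps = f[unfolded self_maps_def] g[unfolded self_maps_def]
  have "pi_bijective i X x X x g" if "i \<le> n" for i
    by (rule pi_bijective_right_inverse[OF maps fg bij[OF that]])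
  then obtain h where h: "h \<in> self_maps X x" and gh: "(g \<circ> h, id) \<in> pair_homotopic X {x} X x"
    by (rule homotopy_right_inverse[OF X g])
  note maps = maps h[unfolded self_maps_def]
  have "(f \<circ> (g \<circ> h), f) \<in> pair_homotopic X {x} X x"
    using pair_homotopic_compose_left[OF gh maps(1)] by simp
  moreover have "(f \<circ> (g \<circ> h), h) \<in> pair_homotopic X {x} X x"
    using pair_homotopic_compose_right[OF fg maps(3)] by (simp add: comp_assoc)
  ultimately have "(f, h) \<in> pair_homotopic X {x} X x"
    by (meson pair_homotopic_sym pair_homotopic_trans)
  from pair_homotopic_compose_left[OF this maps(2)] gh
  have "(g \<circ> f, id) \<in> pair_homotopic X {x} X x" by (rule pair_homotopic_trans)
  with f g fg show ?thesis unfolding based_homotopy_equivalence_def by blast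
qed

theorem theorem2:
  fixes X :: "'a topology" and x :: 'a
    and J :: "'j set" and d :: "'j \<Rightarrow> nat" and \<Phi> :: "'j \<Rightarrow> (nat \<Rightarrow> real) \<Rightarrow> 'a"
    and n :: nat
  assumes "based_CW_complex X x J d \<Phi>"
    and "has_CW_dimension J d n"
    and "connected_space X"
  shows "self_closeness_number X x \<le> enat n"
proof -
  have "based_homotopy_equivalence X x f"
    if "f \<in> self_maps X x" "\<forall>i\<le>n. induces_iso i X x X x f" for f
    by (rule pi_bijective_imp_based_homotopy_equivalence[OF assms that(1)])
       (use that(2) in \<open>blast intro: induces_iso_imp_pi_bijective\<close>)
  moreover have "f \<in> self_maps X x \<and> (\<forall>i\<le>n. induces_iso i X x X x f)"
    if "based_homotopy_equivalence X x f" for f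
    using based_homotopy_equivalence_induces_iso[OF that] that
    unfolding based_homotopy_equivalence_def by blast
  ultimately have "A_sharp n X x = self_equivalence_classes X x"
    unfolding A_sharp_def self_equivalence_classes_def by blast
  then show ?thesis
    unfolding self_closeness_number_def by (auto intro: Least_le)
qed

end
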